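(* Let $V$ be a Banach $\mathbb O$-bimodule, $T\in\mathscr B_{\mathcal{RO}}(V)$ power-associative, $U\subseteq\mathbb O$ a $T$-left-admissible domain, $J\in\mathbb S$ and $m\in\mathbb N$. Then $$\frac1{2\pi}\int_{\partial(U\cap\mathbb C_J)}(R_s-T)^{\circledcirc-}\odot(ds_J\,s^m)=T^m.$$
   Context: $\mathbb O$ is the real octonion algebra with basis $e_0=1,\dots,e_7$, conjugation $\bar x$, norm $|x|$; $\mathbb S=\{J:J^2=-1\}$, $\mathbb C_J=\mathbb R+\mathbb RJ$. An $\mathbb O$-bimodule is a real vector space $M$ with real-bilinear left and right multiplications by $\mathbb O$ (with $1x=x1=x$) whose associators $[p,q,x]=(pq)x-p(qx)$, $[p,x,q]=(px)q-p(xq)$, $[x,p,q]=(xp)q-x(pq)$ satisfy $[p,q,x]=[q,x,p]=[x,p,q]=-[q,p,x]$. $\operatorname{Re}M=\{m: pm=mp,\ [p,q,m]=0\ \forall p,q\}$; every $x=\sum_ix_ie_i$ uniquely with $x_i\in\operatorname{Re}M$, $\operatorname{Re}x:=x_0$. A Banach $\mathbb O$-bimodule has a complete norm with $\|px\|=\|xp\|=|p|\|x\|$. $\mathscr B_{\mathbb R}(V)$: bounded real-linear operators, ordinary powers; invertible means in $\mathscr B_{\mathbb R}(V)$; $R_sv=vs$. $B_p(f,x)=f(x)p-f(xp)$; $\mathscr B_{\mathcal{RO}}(V)$: bounded real-linear $f$ with $\operatorname{Re}B_p(f,x)=0\ \forall p,x$; it is a Banach $\mathbb O$-bimodule (operator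 norm) via $(p\odot f)(x)=pf(x)+B_p(f,x)$, $(f\odot p)(x)=f(px)-B_p(f,x)$. $T$ is power-associative if $T^n\in\mathscr B_{\mathcal{RO}}(V)$ for all $n$. For invertible $S$, $S^{\circledcirc-}=\operatorname{ext}(S^{-1}|_{\operatorname{Re}V})$ with $(\operatorname{ext}h)(\sum x_ie_i)=\sum h(x_i)e_i$. $S$ is $\mathbb C_J$-extendable power associative if $S^n(v\lambda)=S^n(v)\lambda$ for $n\ge1,v\in\operatorname{Re}V,\lambda\in\mathbb C_J$; $\rho_J^*(T)=\{s\in\mathbb C_J:R_s-T$ invertible and $(R_s-T)^{-1}$ $\mathbb C_J$-extendable power associative$\}$, $\sigma^*(T)=\mathbb O\setminus\bigcup_J\rho^*_J(T)$. $U\subseteq\mathbb O$ is axially symmetric if $x+yI\in U$ ($x,y\in\mathbb R$, $I\in\mathbb S$) implies $x+yK\in U$ for all $K\in\mathbb S$; it is a slice domain if it is a domain, $U\cap\mathbb R\ne\emptyset$ and each $U\cap\mathbb C_K$ is a domain in $\mathbb C_K$. $U$ is $T$-left-admissible if it is an axially symmetric slice domain containing $\sigma^*(T)$ such that for every $K\in\mathbb S$, $\partial(U\cap\mathbb C_K)$ is a finite union of continuously differentiable Jordan curves. Integrals over $\partial(U\cap\mathbb C_J)$ are taken with positive orientation: if $s:[a,b]\to\mathbb C_J$ is a piecewise $C^1$ parametrization, $ds_J:=-ds\,J$ and $\int F(s)\odot(ds_Jh(s)):=\int_a^bF(s(t))\odot\big(-s'(t)Jh(s(t))\big)dt$ (Bochner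 integral in $\mathscr B_{\mathcal{RO}}(V)$).
   Formalization: The formal theorem covers only U whose slice U∩C_J is bounded (positive orientation: total winding number 1 inside, 0 outside); for unbounded U, e.g. T=2·id and U={|x|>1}, the integral is 0, not T^m, so the claim as stated fails. *)

theory Defs
  imports "HOL-Complex_Analysis.Complex_Analysis"
begin

type_synonym quat = "complex \<times> complex"
type_synonym oct = "quat \<times> quat"

definition qmult :: "quat \<Rightarrow> quat \<Rightarrow> quat" where
  "qmult x y = (fst x * fst y - cnj (snd y) * snd x, snd y * fst x + snd x * cnj (fst y))"

definition qconj :: "quat \<Rightarrow> quat" where
  "qconj x = (cnj (fst x), - snd x)"

text \<open>Octonion multiplication (Cayley--Dickson doubling of the quaternions).
  The norm of type oct (product norm) is the Euclidean norm, i.e. the octonion norm.\<close>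
definition omult :: "oct \<Rightarrow> oct \<Rightarrow> oct" where
  "omult x y = (qmult (fst x) (fst y) - qmult (qconj (snd y)) (snd x),
                qmult (snd y) (fst x) + qmult (snd x) (qconj (fst y)))"

definition oone :: oct where "oone = ((1, 0), (0, 0))"

definition obasis :: "nat \<Rightarrow> oct" where
  "obasis i = [((1,0),(0,0)), ((\<i>,0),(0,0)), ((0,1),(0,0)), ((0,\<i>),(0,0)),
               ((0,0),(1,0)), ((0,0),(\<i>,0)), ((0,0),(0,1)), ((0,0),(0,\<i>))] ! i"

fun opow :: "oct \<Rightarrow> nat \<Rightarrow> oct" where
  "opow s 0 = oone"
| "opow s (Suc n) = omult s (opow s n)"

definition osphere :: "oct set" where
  "osphere = {J. omult J J = - oone}"

definition cJ :: "oct \<Rightarrow> complex \<Rightarrow> oct" where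
  "cJ J z = Re z *\<^sub>R oone + Im z *\<^sub>R J"

definition CJ :: "oct \<Rightarrow> oct set" where
  "CJ J = range (cJ J)"

text \<open>L p x = p x (left multiplication), R x p = x p (right multiplication).\<close>
definition O_bimodule :: "(oct \<Rightarrow> 'v::real_vector \<Rightarrow> 'v) \<Rightarrow> ('v \<Rightarrow> oct \<Rightarrow> 'v) \<Rightarrow> bool" where
  "O_bimodule L R \<longleftrightarrow>
     (\<forall>p. linear (L p)) \<and> (\<forall>x. linear (\<lambda>p. L p x)) \<and>
     (\<forall>p. linear (\<lambda>x. R x p)) \<and> (\<forall>x. linear (R x)) \<and>
     (\<forall>x. L oone x = x \<and> R x oone = x) \<and>
     (\<forall>p q x.
        let a_pqx = L (omult p q) x - L p (L q x);
            a_qxp = R (L q x) p - L q (R x p);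
            a_xpq = R (R x p) q - R x (omult p q);
            a_qpx = L (omult q p) x - L q (L p x)
        in a_pqx = a_qxp \<and> a_qxp = a_xpq \<and> a_xpq = - a_qpx)"

definition banach_O_bimodule :: "(oct \<Rightarrow> 'v::banach \<Rightarrow> 'v) \<Rightarrow> ('v \<Rightarrow> oct \<Rightarrow> 'v) \<Rightarrow> bool" where
  "banach_O_bimodule L R \<longleftrightarrow> O_bimodule L R \<and>
     (\<forall>p x. norm (L p x) = norm p * norm x \<and> norm (R x p) = norm p * norm x)"

definition ReV :: "(oct \<Rightarrow> 'v::real_vector \<Rightarrow> 'v) \<Rightarrow> ('v \<Rightarrow> oct \<Rightarrow> 'v) \<Rightarrow> 'v set" where
  "ReV L R = {m. \<forall>p q. L p m = R m p \<and> L (omult p q) m - L p (L q m) = 0}"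

definition ocomp :: "(oct \<Rightarrow> 'v::real_vector \<Rightarrow> 'v) \<Rightarrow> ('v \<Rightarrow> oct \<Rightarrow> 'v) \<Rightarrow> 'v \<Rightarrow> nat \<Rightarrow> 'v" where
  "ocomp L R x = (THE c. (\<forall>i<8. c i \<in> ReV L R) \<and> (\<forall>i\<ge>8. c i = 0) \<and>
                         x = (\<Sum>i<8. R (c i) (obasis i)))"

definition ReP :: "(oct \<Rightarrow> 'v::real_vector \<Rightarrow> 'v) \<Rightarrow> ('v \<Rightarrow> oct \<Rightarrow> 'v) \<Rightarrow> 'v \<Rightarrow> 'v" where
  "ReP L R x = ocomp L R x 0"

definition Bp :: "('v \<Rightarrow> oct \<Rightarrow> 'v) \<Rightarrow> oct \<Rightarrow> ('v \<Rightarrow> 'v) \<Rightarrow> 'v \<Rightarrow> 'v::real_vector" where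
  "Bp R p f x = R (f x) p - f (R x p)"

definition B_RO :: "(oct \<Rightarrow> 'v::real_normed_vector \<Rightarrow> 'v) \<Rightarrow> ('v \<Rightarrow> oct \<Rightarrow> 'v) \<Rightarrow> ('v \<Rightarrow> 'v) set" where
  "B_RO L R = {f. bounded_linear f \<and> (\<forall>p x. ReP L R (Bp R p f x) = 0)}"

text \<open>Right module action on B_RO(V): (f . p)(x) = f(p x) - B_p(f,x).\<close>
definition op_rmult :: "(oct \<Rightarrow> 'v::real_normed_vector \<Rightarrow> 'v) \<Rightarrow> ('v \<Rightarrow> oct \<Rightarrow> 'v) \<Rightarrow> ('v \<Rightarrow> 'v) \<Rightarrow> oct \<Rightarrow> 'v \<Rightarrow> 'v" where
  "op_rmult L R f p x = f (L p x) - Bp R p f x"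

definition power_associative :: "(oct \<Rightarrow> 'v::real_normed_vector \<Rightarrow> 'v) \<Rightarrow> ('v \<Rightarrow> oct \<Rightarrow> 'v) \<Rightarrow> ('v \<Rightarrow> 'v) \<Rightarrow> bool" where
  "power_associative L R T \<longleftrightarrow> (\<forall>n. T ^^ n \<in> B_RO L R)"

definition invertible_op :: "('v::real_normed_vector \<Rightarrow> 'v) \<Rightarrow> bool" where
  "invertible_op A \<longleftrightarrow> bounded_linear A \<and>
     (\<exists>S. bounded_linear S \<and> S \<circ> A = id \<and> A \<circ> S = id)"

definition oext :: "(oct \<Rightarrow> 'v::real_normed_vector \<Rightarrow> 'v) \<Rightarrow> ('v \<Rightarrow> oct \<Rightarrow> 'v) \<Rightarrow> ('v \<Rightarrow> 'v) \<Rightarrow> 'v \<Rightarrow> 'v" where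
  "oext L R h x = (\<Sum>i<8. R (h (ocomp L R x i)) (obasis i))"

definition ocirc_inv :: "(oct \<Rightarrow> 'v::real_normed_vector \<Rightarrow> 'v) \<Rightarrow> ('v \<Rightarrow> oct \<Rightarrow> 'v) \<Rightarrow> ('v \<Rightarrow> 'v) \<Rightarrow> 'v \<Rightarrow> 'v" where
  "ocirc_inv L R S = oext L R (restrict (inv S) (ReV L R))"

definition CJ_ext_power_assoc :: "(oct \<Rightarrow> 'v::real_normed_vector \<Rightarrow> 'v) \<Rightarrow> ('v \<Rightarrow> oct \<Rightarrow> 'v) \<Rightarrow> oct \<Rightarrow> ('v \<Rightarrow> 'v) \<Rightarrow> bool" where
  "CJ_ext_power_assoc L R J S \<longleftrightarrow>
     (\<forall>n\<ge>1. \<forall>v\<in>ReV L R. \<forall>c\<in>CJ J. (S ^^ n) (R v c) = R ((S ^^ n) v) c)"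

definition rho_star :: "(oct \<Rightarrow> 'v::real_normed_vector \<Rightarrow> 'v) \<Rightarrow> ('v \<Rightarrow> oct \<Rightarrow> 'v) \<Rightarrow> ('v \<Rightarrow> 'v) \<Rightarrow> oct \<Rightarrow> oct set" where
  "rho_star L R T J = {s \<in> CJ J. invertible_op (\<lambda>v. R v s - T v) \<and>
                         CJ_ext_power_assoc L R J (inv (\<lambda>v. R v s - T v))}"

definition sigma_star :: "(oct \<Rightarrow> 'v::real_normed_vector \<Rightarrow> 'v) \<Rightarrow> ('v \<Rightarrow> oct \<Rightarrow> 'v) \<Rightarrow> ('v \<Rightarrow> 'v) \<Rightarrow> oct set" where
  "sigma_star L R T = UNIV - (\<Union>J\<in>osphere. rho_star L R T J)"

definition axially_symmetric :: "oct set \<Rightarrow> bool" where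
  "axially_symmetric U \<longleftrightarrow> (\<forall>x y I K. I \<in> osphere \<longrightarrow> K \<in> osphere \<longrightarrow>
      x *\<^sub>R oone + y *\<^sub>R I \<in> U \<longrightarrow> x *\<^sub>R oone + y *\<^sub>R K \<in> U)"

definition oslice :: "oct set \<Rightarrow> oct \<Rightarrow> complex set" where
  "oslice U K = {z. cJ K z \<in> U}"

definition slice_domain :: "oct set \<Rightarrow> bool" where
  "slice_domain U \<longleftrightarrow> open U \<and> connected U \<and> U \<noteq> {} \<and> (\<exists>r. r *\<^sub>R oone \<in> U) \<and>
     (\<forall>K\<in>osphere. open (oslice U K) \<and> connected (oslice U K) \<and> oslice U K \<noteq> {})"

definition C1_Jordan_curve :: "(real \<Rightarrow> complex) \<Rightarrow> bool" where
  "C1_Jordan_curve g \<longleftrightarrow> simple_path g \<and> pathfinish g = pathstart g \<and>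
      g C1_differentiable_on {0..1}"

definition left_admissible :: "(oct \<Rightarrow> 'v::real_normed_vector \<Rightarrow> 'v) \<Rightarrow> ('v \<Rightarrow> oct \<Rightarrow> 'v) \<Rightarrow> ('v \<Rightarrow> 'v) \<Rightarrow> oct set \<Rightarrow> bool" where
  "left_admissible L R T U \<longleftrightarrow> axially_symmetric U \<and> slice_domain U \<and>
     sigma_star L R T \<subseteq> U \<and>
     (\<forall>K\<in>osphere. \<exists>G. finite G \<and> (\<forall>g\<in>G. C1_Jordan_curve g) \<and>
                     frontier (oslice U K) = (\<Union>g\<in>G. path_image g))"

text \<open>A positively oriented parametrisation of the boundary of an (open) planar set D by
  finitely many piecewise C^1 closed Jordan paths: images cover the boundary, total winding
  number 1 around points of D and 0 around points outside the closure.\<close>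
definition pos_boundary_param :: "complex set \<Rightarrow> (real \<Rightarrow> complex) list \<Rightarrow> bool" where
  "pos_boundary_param D gs \<longleftrightarrow>
     (\<forall>g\<in>set gs. valid_path g \<and> simple_path g \<and> pathfinish g = pathstart g) \<and>
     (\<Union>g\<in>set gs. path_image g) = frontier D \<and>
     (\<forall>z\<in>D. (\<Sum>g\<leftarrow>gs. winding_number g z) = 1) \<and>
     (\<forall>z. z \<notin> closure D \<longrightarrow> (\<Sum>g\<leftarrow>gs. winding_number g z) = 0)"

definition integrand :: "(oct \<Rightarrow> 'v::real_normed_vector \<Rightarrow> 'v) \<Rightarrow> ('v \<Rightarrow> oct \<Rightarrow> 'v) \<Rightarrow> ('v \<Rightarrow> 'v) \<Rightarrow> oct \<Rightarrow> nat \<Rightarrow>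
    (real \<Rightarrow> complex) \<Rightarrow> real \<Rightarrow> 'v \<Rightarrow>\<^sub>L 'v" where
  "integrand L R T J m g t =
     (let s = cJ J (g t); s' = cJ J (vector_derivative g (at t))
      in Blinfun (op_rmult L R (ocirc_inv L R (\<lambda>v. R v s - T v))
                    (omult (omult (- s') J) (opow s m))))"

end

theory Submission
  imports Defs
begin

text \<open>An octonionic bimodule is V = Re V \<otimes> O, and a bounded operator f belongs to B_RO(V) if and only if
  f(vp) = f(v)p for v in Re V. Hence both sides of the formula are determined by their values on Re V, where
  the integrand at v is (R_s - T)^{-1}(v) multiplied by a scalar of C_J on the right.

  Extendable power associativity lets the Neumann series at a point of the resolvent set be written as a power
  series with right C_J-scalars, so s \<mapsto> (R_s - T)^{-1}(v) is holomorphic for the right C_J-structure of V.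
  After applying bounded functionals that are linear for this structure, the contours can be deformed:
  a boundary curve with the slice of U outside it contributes 0, one with the slice inside can be
  moved to a large circle, and there s^m (R_s - T)^{-1}(v) = T^m(v) s^{-1} + polynomial + O(s^{-2}).\<close>

section \<open>Octonions and octonionic bimodules\<close>

lemma sum_lt8: "(\<Sum>i<8. f i) = f 0 + f 1 + f 2 + f 3 + f 4 + f 5 + f 6 + f (7::nat)"
  by (simp add: eval_nat_numeral)

lemma all_lt8: "(\<forall>i<8. P i) \<longleftrightarrow> P 0 \<and> P 1 \<and> P 2 \<and> P 3 \<and> P 4 \<and> P 5 \<and> P 6 \<and> P (7::nat)"
  by (simp add: eval_nat_numeral All_less_Suc conj_ac)

declare One_nat_def [simp del] split_paired_All [simp del]

lemma obasis_simps:
  "obasis 0 = ((1,0),(0,0))" "obasis 1 = ((\<i>,0),(0,0))" "obasis 2 = ((0,1),(0,0))"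
  "obasis 3 = ((0,\<i>),(0,0))" "obasis 4 = ((0,0),(1,0))" "obasis 5 = ((0,0),(\<i>,0))"
  "obasis 6 = ((0,0),(0,1))" "obasis 7 = ((0,0),(0,\<i>))"
  by (simp_all add: obasis_def One_nat_def)

lemma obasis_0: "obasis 0 = oone"
  by (simp add: obasis_simps oone_def zero_prod_def)

lemma omult_add: "omult (x + y) z = omult x z + omult y z" "omult x (y + z) = omult x y + omult x z"
  by (simp_all add: omult_def qmult_def qconj_def algebra_simps prod_eq_iff)

lemma omult_scaleR: "omult (a *\<^sub>R x) y = a *\<^sub>R omult x y" "omult x (a *\<^sub>R y) = a *\<^sub>R omult x y"
  by (simp_all add: omult_def qmult_def qconj_def algebra_simps prod_eq_iff complex_eq_iff)

lemma omult_minus: "omult (- x) y = - omult x y" "omult x (- y) = - omult x y"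
  using omult_scaleR(1)[of "-1"] omult_scaleR(2)[of _ "-1"] by simp_all

lemma omult_one [simp]: "omult oone x = x" "omult x oone = x"
  by (simp_all add: omult_def qmult_def qconj_def oone_def prod_eq_iff)

lemmas obasis_omult = omult_def qmult_def qconj_def oone_def obasis_simps zero_prod_def

lemma inner_obasis: "i < 8 \<Longrightarrow> j < 8 \<Longrightarrow> inner (obasis i) (obasis j) = (if i = j then 1 else 0)"
proof -
  have "\<forall>i<8. \<forall>j<8. inner (obasis i) (obasis j) = (if i = j then 1 else 0)"
    unfolding all_lt8 by (simp add: obasis_simps inner_prod_def)
  then show "i < 8 \<Longrightarrow> j < 8 \<Longrightarrow> ?thesis" by blast
qed

lemma obasis_expand: "(\<Sum>i<8. inner p (obasis i) *\<^sub>R obasis i) = p"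
  by (simp add: sum_lt8 obasis_simps inner_prod_def prod_eq_iff complex_eq_iff inner_complex_def)

lemma inner_oone_assoc: "inner (omult (omult a b) c) oone = inner (omult a (omult b c)) oone"
  by (simp add: omult_def qmult_def qconj_def oone_def inner_prod_def inner_complex_def algebra_simps)

lemma antisymmetric_part:
  fixes a b c :: "'a::real_vector"
  assumes "a = b - 2 *\<^sub>R c" "b + a = 0"
  shows "a = - c"
proof -
  have "b = - a" using assms(2) by (simp add: eq_neg_iff_add_eq_0)
  with assms(1) have "a + a = - (2 *\<^sub>R c)" by (metis add_uminus_conv_diff add.assoc add.right_inverse add_0)
  then have "2 *\<^sub>R a = 2 *\<^sub>R (- c)" by (simp add: scaleR_2)
  then show ?thesis by (simp only: real_vector.scale_cancel_left) simp
qed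

definition oconj :: "oct \<Rightarrow> oct" where
  "oconj p = (2 * inner p oone) *\<^sub>R oone - p"

lemma inner_oone_oconj: "inner (omult p (oconj q)) oone = inner p q"
  by (simp add: oconj_def omult_def qmult_def qconj_def oone_def inner_prod_def inner_complex_def algebra_simps)

definition quaternion_triple :: "oct \<Rightarrow> oct \<Rightarrow> oct \<Rightarrow> bool" where
  "quaternion_triple p q k \<longleftrightarrow>
     omult p p = - oone \<and> omult q q = - oone \<and> omult k k = - oone \<and>
     omult p q = k \<and> omult q p = - k \<and> omult q k = p \<and> omult k q = - p \<and>
     omult k p = q \<and> omult p k = - q"

lemma quaternion_triple_rotate: "quaternion_triple p q k \<Longrightarrow> quaternion_triple q k p"
  by (simp add: quaternion_triple_def)

lemma quaternion_triple_obasis: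
  "quaternion_triple (obasis 1) (obasis 2) (obasis 3)" "quaternion_triple (obasis 1) (obasis 4) (obasis 5)"
  "quaternion_triple (obasis 1) (obasis 7) (obasis 6)" "quaternion_triple (obasis 2) (obasis 4) (obasis 6)"
  "quaternion_triple (obasis 2) (obasis 5) (obasis 7)" "quaternion_triple (obasis 3) (obasis 4) (obasis 7)"
  "quaternion_triple (obasis 3) (obasis 6) (obasis 5)"
  by (simp_all add: quaternion_triple_def obasis_omult)

locale octonion_bimodule =
  fixes L :: "oct \<Rightarrow> 'v::real_vector \<Rightarrow> 'v" and R :: "'v \<Rightarrow> oct \<Rightarrow> 'v"
  assumes bimod: "O_bimodule L R"
begin

lemma linear_L: "linear (L p)" and linear_L': "linear (\<lambda>p. L p x)"
  and linear_R: "linear (\<lambda>x. R x p)" and linear_R': "linear (R x)"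
  and L_one [simp]: "L oone x = x" and R_one [simp]: "R x oone = x"
  using bimod unfolding O_bimodule_def by blast+

lemmas L_simps = linear_add[OF linear_L] linear_diff[OF linear_L] linear_neg[OF linear_L]
  linear_0[OF linear_L] linear_cmul[OF linear_L]
lemmas L_simps' = linear_add[OF linear_L'] linear_diff[OF linear_L'] linear_neg[OF linear_L']
  linear_0[OF linear_L'] linear_cmul[OF linear_L']
lemmas R_simps = linear_add[OF linear_R] linear_diff[OF linear_R] linear_neg[OF linear_R]
  linear_0[OF linear_R] linear_cmul[OF linear_R]
lemmas R_simps' = linear_add[OF linear_R'] linear_diff[OF linear_R'] linear_neg[OF linear_R']
  linear_0[OF linear_R'] linear_cmul[OF linear_R']

lemma assoc_mid: "R (L q x) p - L q (R x p) = L (omult p q) x - L p (L q x)"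
  and assoc_right: "R (R x p) q - R x (omult p q) = L (omult p q) x - L p (L q x)"
  and assoc_flip: "L (omult p q) x - L p (L q x) = - (L (omult q p) x - L q (L p x))"
  using bimod unfolding O_bimodule_def Let_def by metis+

lemma L_anticommute: "omult p q + omult q p = 0 \<Longrightarrow> L p (L q x) = - L q (L p x)"
proof -
  assume "omult p q + omult q p = 0"
  then have "L (omult p q) x + L (omult q p) x = 0" by (simp add: L_simps'(1)[symmetric] L_simps'(4))
  then have "- L p (L q x) = L q (L p x)"
    using assoc_flip[of p q x] by (simp add: algebra_simps eq_neg_iff_add_eq_0)
  then show ?thesis by (metis minus_minus)
qed

lemma L_square: "L p (L p x) = L (omult p p) x"
proof -
  have "L (omult p p) x - L p (L p x) = - (L (omult p p) x - L p (L p x))" by (rule assoc_flip)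
  then have "2 *\<^sub>R (L (omult p p) x - L p (L p x)) = 0" by (metis scaleR_2 add.left_inverse)
  then show ?thesis by simp
qed

lemma R_square: "R (R x p) p = R x (omult p p)"
  using assoc_right[of x p p] L_square[of p x] by simp

text \<open>With A x = [p, q, x] one has R p L q = L q R p + A; multiplying by R p, whose square is -1, shows
  that R p anticommutes with A.\<close>
lemma R_associator:
  assumes triple: "quaternion_triple p q k"
  shows "R (L k x - L p (L q x)) p = - L p (L k x - L p (L q x))"
proof -
  note assms = triple[unfolded quaternion_triple_def]
  define A where "A y = L k y - L p (L q y)" for y
  have comm: "R (L q y) p = L q (R y p) + A y" for y
    using assoc_mid[of q y p] assms by (simp add: A_def diff_eq_eq add.commute)
  have comm_p: "R (L p y) p = L p (R y p)" for y
    using assoc_mid[of p y p] L_square[of p y] by simp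
  have "L (omult p k) y = - L q y" for y using assms by (simp add: L_simps')
  then have comm_k: "R (L k y) p = L k (R y p) - L q y - L p (L k y)" for y
    using assoc_mid[of k y p] by (simp add: algebra_simps)
  have pp: "L p (L p y) = - y" for y using assms L_square[of p y] by (simp add: L_simps')
  have "R (A x) p = A (R x p) - 2 *\<^sub>R L p (A x)"
    by (simp add: A_def R_simps L_simps comm comm_k comm_p pp scaleR_2 algebra_simps)
  moreover have "R (R (L q x) p) p = - L q x"
    using R_square[of "L q x" p] assms by (simp add: R_simps')
  then have "A (R x p) + R (A x) p = 0"
    using R_square[of x p] assms by (simp add: comm R_simps R_simps' L_simps)
  ultimately show ?thesis
    unfolding A_def by (rule antisymmetric_part)
qed

lemma L_triple:
  assumes "quaternion_triple p q k"
  shows "L p (L p y) = - y" "L q (L p y) = - L p (L q y)"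
  using assms L_square[of p y] L_anticommute[of q p y]
  by (simp_all add: quaternion_triple_def L_simps')

lemma L_triple_neg:
  assumes triple: "quaternion_triple p q k" and tau: "L p (L q (L k x)) = - x"
  shows "L k x = L p (L q x)"
proof -
  note pq = L_triple[OF triple] and qk = L_triple[OF quaternion_triple_rotate[OF triple]]
  have "L p (L p (L q (L k x))) = - L p x" using tau by (simp add: L_simps)
  then have "L q (L k x) = L p x" by (simp add: pq)
  then have "L q (L q (L k x)) = L q (L p x)" by simp
  then show ?thesis by (simp add: pq qk)
qed

lemma R_eq_neg_L:
  assumes triple: "quaternion_triple p q k" and tau: "L p (L q (L k x)) = x"
  shows "R x p = - L p x"
proof -
  note pq = L_triple[OF triple] and qk = L_triple[OF quaternion_triple_rotate[OF triple]]
    and kp = L_triple[OF quaternion_triple_rotate[OF quaternion_triple_rotate[OF triple]]]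
  define y where "y = L p (L q x)"
  have "L k y = - L p (L k (L q x))" unfolding y_def by (metis kp(2) minus_minus)
  then have "L k y = x" by (simp add: qk(2) L_simps tau)
  moreover have "L p (L q y) = - x"
    by (simp add: y_def pq qk L_simps)
  ultimately have "R (2 *\<^sub>R x) p = - L p (2 *\<^sub>R x)"
    using R_associator[OF triple, of y] by (simp add: scaleR_2)
  then have "2 *\<^sub>R R x p = 2 *\<^sub>R (- L p x)" by (simp add: R_simps L_simps)
  then show ?thesis by (simp only: real_vector.scale_cancel_left) simp
qed

definition l :: "nat \<Rightarrow> 'v \<Rightarrow> 'v" where "l i = L (obasis i)"

lemma l_linear: "l i (x + y) = l i x + l i y" "l i (x - y) = l i x - l i y" "l i (- x) = - l i x"
  "l i (c *\<^sub>R x) = c *\<^sub>R l i x" "l i 0 = 0"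
  by (simp_all add: l_def L_simps)

text \<open>The ordering 1, 2, 4, 3, 5, 6, 7 of the indices normalises words in the l i so that the three
  generators 1, 2, 4 of the octonions come first.\<close>
lemma l_clifford:
  "l 2 (l 1 x) = - l 1 (l 2 x)" "l 4 (l 1 x) = - l 1 (l 4 x)" "l 3 (l 1 x) = - l 1 (l 3 x)"
  "l 5 (l 1 x) = - l 1 (l 5 x)" "l 6 (l 1 x) = - l 1 (l 6 x)" "l 7 (l 1 x) = - l 1 (l 7 x)"
  "l 4 (l 2 x) = - l 2 (l 4 x)" "l 3 (l 2 x) = - l 2 (l 3 x)" "l 5 (l 2 x) = - l 2 (l 5 x)"
  "l 6 (l 2 x) = - l 2 (l 6 x)" "l 7 (l 2 x) = - l 2 (l 7 x)" "l 3 (l 4 x) = - l 4 (l 3 x)"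
  "l 5 (l 4 x) = - l 4 (l 5 x)" "l 6 (l 4 x) = - l 4 (l 6 x)" "l 7 (l 4 x) = - l 4 (l 7 x)"
  "l 5 (l 3 x) = - l 3 (l 5 x)" "l 6 (l 3 x) = - l 3 (l 6 x)" "l 7 (l 3 x) = - l 3 (l 7 x)"
  "l 6 (l 5 x) = - l 5 (l 6 x)" "l 7 (l 5 x) = - l 5 (l 7 x)" "l 7 (l 6 x) = - l 6 (l 7 x)"
  "l 1 (l 1 x) = - x" "l 2 (l 2 x) = - x" "l 3 (l 3 x) = - x" "l 4 (l 4 x) = - x" "l 5 (l 5 x) = - x"
  "l 6 (l 6 x) = - x" "l 7 (l 7 x) = - x"
proof -
  have anti: "l i (l j x) = - l j (l i x)"
    if "omult (obasis i) (obasis j) + omult (obasis j) (obasis i) = 0" for i j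
    using L_anticommute[OF that] by (simp add: l_def)
  have square: "l i (l i x) = - x" if "omult (obasis i) (obasis i) = - oone" for i
    using L_square[of "obasis i" x] that by (simp add: l_def L_simps')
  show
    "l 2 (l 1 x) = - l 1 (l 2 x)" "l 4 (l 1 x) = - l 1 (l 4 x)" "l 3 (l 1 x) = - l 1 (l 3 x)"
    "l 5 (l 1 x) = - l 1 (l 5 x)" "l 6 (l 1 x) = - l 1 (l 6 x)" "l 7 (l 1 x) = - l 1 (l 7 x)"
    "l 4 (l 2 x) = - l 2 (l 4 x)" "l 3 (l 2 x) = - l 2 (l 3 x)" "l 5 (l 2 x) = - l 2 (l 5 x)"
    "l 6 (l 2 x) = - l 2 (l 6 x)" "l 7 (l 2 x) = - l 2 (l 7 x)" "l 3 (l 4 x) = - l 4 (l 3 x)"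
    "l 5 (l 4 x) = - l 4 (l 5 x)" "l 6 (l 4 x) = - l 4 (l 6 x)" "l 7 (l 4 x) = - l 4 (l 7 x)"
    "l 5 (l 3 x) = - l 3 (l 5 x)" "l 6 (l 3 x) = - l 3 (l 6 x)" "l 7 (l 3 x) = - l 3 (l 7 x)"
    "l 6 (l 5 x) = - l 5 (l 6 x)" "l 7 (l 5 x) = - l 5 (l 7 x)" "l 7 (l 6 x) = - l 6 (l 7 x)"
    "l 1 (l 1 x) = - x" "l 2 (l 2 x) = - x" "l 3 (l 3 x) = - x" "l 4 (l 4 x) = - x" "l 5 (l 5 x) = - x"
    "l 6 (l 6 x) = - x" "l 7 (l 7 x) = - x"
    by (rule anti square; simp add: obasis_omult)+
qed

lemmas l_simps = l_linear l_clifford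
lemma l_0: "l 0 x = x"
  by (simp add: l_def obasis_0)

lemmas omult_table = quaternion_triple_obasis[unfolded quaternion_triple_def]

text \<open>The Clifford relations of left multiplication admit two inequivalent irreducible modules. The sign
  choice in the fourth hypothesis selects the wrong one, and only right multiplication excludes it:
  R 2 = - L 2 both on z and on L 4 z, while R 2 and L 4 commute on z although L 2 and L 4 anticommute.\<close>
lemma no_exotic_summand:
  assumes a: "l 1 (l 2 (l 3 x)) = - x" and b: "l 1 (l 4 (l 5 x)) = - x"
    and c: "l 2 (l 4 (l 6 x)) = - x" and d: "l 1 (l 7 (l 6 x)) = x"
  shows "x = 0"
proof -
  note trip = quaternion_triple_obasis
  have l3: "l 3 x = l 1 (l 2 x)" and l5: "l 5 x = l 1 (l 4 x)" and l6: "l 6 x = l 2 (l 4 x)"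
    using L_triple_neg[OF trip(1)] L_triple_neg[OF trip(2)] L_triple_neg[OF trip(4)] a b c
    by (simp_all add: l_def)
  have "l 6 (l 7 x) = l 1 x" using arg_cong[OF d, of "l 1"] by (simp add: l_simps)
  then have "l 6 (l 6 (l 7 x)) = l 6 (l 1 x)" by simp
  then have l7: "l 7 x = l 1 (l 2 (l 4 x))" by (simp add: l_simps l6)
  define z where "z = l 1 (l 7 x)"
  have z: "z = - l 2 (l 4 x)" by (simp add: z_def l7 l_simps)
  have "R z (obasis 2) = - l 2 z"
    unfolding l_def
    by (rule R_eq_neg_L[OF quaternion_triple_rotate[OF trip(1)]])
      (simp add: l_def[symmetric] z l_simps l3)
  moreover have "R (l 4 z) (obasis 2) = - l 2 (l 4 z)"
    unfolding l_def
    by (rule R_eq_neg_L[OF trip(5)]) (simp add: l_def[symmetric] z l_simps l5 l7)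
  moreover have "l 6 z = l 2 (l 4 z)"
    unfolding l_def
    by (rule L_triple_neg[OF trip(4)]) (simp add: l_def[symmetric] z l_simps l6)
  then have "R (l 4 z) (obasis 2) = l 4 (R z (obasis 2))"
    using assoc_mid[of "obasis 4" z "obasis 2"] by (simp add: omult_table l_def)
  ultimately have "l 2 (l 4 z) = - l 2 (l 4 z)" by (simp add: l_simps)
  then have "2 *\<^sub>R l 2 (l 4 z) = 0" by (metis scaleR_2 add.left_inverse)
  then show ?thesis by (simp add: z l_simps)
qed

lemma associator_commutes:
  assumes nuc: "\<And>p q. L (omult p q) y = L p (L q y)"
  shows "R y (omult (omult a b) c - omult a (omult b c)) = L (omult (omult a b) c - omult a (omult b c)) y"
proof -
  have nm: "R (L q y) p = L q (R y p)" for p q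
    using assoc_mid[of q y p] nuc by simp
  have nr: "R y (omult p q) = R (R y p) q" for p q
    using assoc_right[of y p q] nuc by simp
  have "R y (omult (omult a b) c - omult a (omult b c)) = R (R (R y a) b) c - R (R y a) (omult b c)"
    by (simp add: R_simps' nr)
  also have "\<dots> = R (L b (L c y)) a - L b (R (L c y) a)"
    using assoc_right[of "R y a" b c] by (simp add: nm nuc[symmetric])
  also have "\<dots> = L (omult (omult a b) c - omult a (omult b c)) y"
    using assoc_mid[of b "L c y" a] by (simp add: nuc L_simps')
  finally show ?thesis .
qed

lemma linear_eq_obasis:
  assumes "linear f" "linear g" "\<And>i. i < 8 \<Longrightarrow> f (obasis i) = g (obasis i)"
  shows "f p = g p"
proof -
  have "f (\<Sum>i<8. inner p (obasis i) *\<^sub>R obasis i) = g (\<Sum>i<8. inner p (obasis i) *\<^sub>R obasis i)"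
    by (simp only: linear_sum[OF assms(1)] linear_sum[OF assms(2)] linear_cmul[OF assms(1)]
      linear_cmul[OF assms(2)]) (simp add: assms(3))
  then show ?thesis by (simp only: obasis_expand)
qed

lemma ReV_iff_nucleus: "x \<in> ReV L R \<longleftrightarrow> (\<forall>p q. L (omult p q) x = L p (L q x))"
proof
  assume nuc: "\<forall>p q. L (omult p q) x = L p (L q x)"
  have "R x p = L p x" for p
  proof (rule linear_eq_obasis[OF linear_R' linear_L'])
    note comm = associator_commutes[of x, OF nuc[rule_format]]
    have "\<forall>i<8. 2 *\<^sub>R R x (obasis i) = 2 *\<^sub>R L (obasis i) x"
      unfolding all_lt8
      using comm[of "obasis 2" "obasis 5" "obasis 6"] comm[of "obasis 1" "obasis 4" "obasis 7"]
        comm[of "obasis 1" "obasis 6" "obasis 4"] comm[of "obasis 1" "obasis 3" "obasis 6"]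
        comm[of "obasis 1" "obasis 2" "obasis 6"] comm[of "obasis 1" "obasis 4" "obasis 3"]
        comm[of "obasis 1" "obasis 2" "obasis 4"]
      by (simp add: omult_table omult_minus obasis_0 L_simps' R_simps' scaleR_2)
    then show "i < 8 \<Longrightarrow> R x (obasis i) = L (obasis i) x" for i
      by simp
  qed
  with nuc show "x \<in> ReV L R" by (simp add: ReV_def)
next
  assume "x \<in> ReV L R"
  then have "\<forall>p q. L (omult p q) x - L p (L q x) = 0" unfolding ReV_def by blast
  then show "\<forall>p q. L (omult p q) x = L p (L q x)" by simp
qed

lemma ReV_if_tau:
  assumes a: "l 1 (l 2 (l 3 x)) = - x" and b: "l 1 (l 4 (l 5 x)) = - x"
    and c: "l 2 (l 4 (l 6 x)) = - x"
  shows "x \<in> ReV L R"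
proof -
  note trip = quaternion_triple_obasis
  have l3: "l 3 x = l 1 (l 2 x)" and l5: "l 5 x = l 1 (l 4 x)" and l6: "l 6 x = l 2 (l 4 x)"
    using L_triple_neg[OF trip(1)] L_triple_neg[OF trip(2)] L_triple_neg[OF trip(4)] a b c
    by (simp_all add: l_def)
  have neg: "a = - b" if "- a = b" for a b :: 'v using that by auto
  have "l 3 (l 7 x) = - l 1 (l 2 (l 7 x))" "l 5 (l 7 x) = - l 1 (l 4 (l 7 x))"
    "l 6 (l 7 x) = - l 2 (l 4 (l 7 x))"
    by (rule neg, use arg_cong[OF l3, of "l 7"] arg_cong[OF l5, of "l 7"] arg_cong[OF l6, of "l 7"]
      in \<open>simp add: l_simps\<close>)+
  then have "x + l 1 (l 7 (l 6 x)) = 0"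
    by (intro no_exotic_summand) (simp_all add: l_simps l3 l5 l6)
  then have "L (obasis 1) (L (obasis 7) (L (obasis 6) x)) = - x"
    by (simp add: l_def add_eq_0_iff)
  from L_triple_neg[OF trip(3) this] have "l 1 (l 7 x) = l 6 x" by (simp add: l_def)
  then have "l 1 (l 1 (l 7 x)) = l 1 (l 6 x)" by simp
  then have l7: "l 7 x = - l 1 (l 2 (l 4 x))" by (intro neg) (simp add: l_simps l6)
  have table: "\<forall>i<8. \<forall>j<8. L (omult (obasis i) (obasis j)) x = l i (l j x)"
    unfolding all_lt8
    by (simp add: omult_table obasis_0 L_simps' l_def[symmetric] l_0 l_simps l3 l5 l6 l7) 
  have "L (omult p q) x = L p (L q x)" for p q
  proof (rule linear_eq_obasis[where f = "\<lambda>p. L (omult p q) x"])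
    show "linear (\<lambda>p. L (omult p q) x)"
      by (simp add: linear_iff omult_add omult_scaleR L_simps')
    fix i :: nat assume "i < 8"
    show "L (omult (obasis i) q) x = L (obasis i) (L q x)"
    proof (rule linear_eq_obasis[where p = q])
      show "linear (\<lambda>q. L (omult (obasis i) q) x)" "linear (\<lambda>q. L (obasis i) (L q x))"
        by (simp_all add: linear_iff omult_add omult_scaleR L_simps' L_simps)
    qed (use table \<open>i < 8\<close> in \<open>simp add: l_def\<close>)
  qed (rule linear_L')
  then show ?thesis by (simp add: ReV_iff_nucleus)
qed

text \<open>The product of (1 - t)/2 over the commuting involutions t = l i l j l k for the three lines 123, 145
  and 246 of the Fano plane.\<close>
definition real_proj :: "'v \<Rightarrow> 'v" where
  "real_proj x = (1/8) *\<^sub>R (x - l 1 (l 2 (l 3 x)) - l 1 (l 4 (l 5 x)) - l 2 (l 4 (l 6 x))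
     + l 1 (l 2 (l 3 (l 1 (l 4 (l 5 x))))) + l 1 (l 2 (l 3 (l 2 (l 4 (l 6 x)))))
     + l 1 (l 4 (l 5 (l 2 (l 4 (l 6 x))))) - l 1 (l 2 (l 3 (l 1 (l 4 (l 5 (l 2 (l 4 (l 6 x)))))))))"

lemma real_proj_ReV: "real_proj x \<in> ReV L R"
  by (rule ReV_if_tau; simp add: real_proj_def l_simps algebra_simps)

lemma real_proj_expand:
  "x = real_proj x - (\<Sum>i\<in>{1..<8}. l i (real_proj (l i x)))"
proof -
  have "{1..<8} = {1,2,3,4,5,6,7::nat}" by auto
  then show ?thesis by (simp add: real_proj_def l_simps algebra_simps scaleR_add_left[symmetric])
qed

lemma linear_real_proj: "linear real_proj"
  by (simp add: linear_iff real_proj_def l_simps algebra_simps)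

lemma ReV_tau:
  assumes "x \<in> ReV L R"
  shows "l 1 (l 2 (l 3 x)) = - x" "l 1 (l 4 (l 5 x)) = - x" "l 2 (l 4 (l 6 x)) = - x"
proof -
  have "L (omult p q) x = L p (L q x)" for p q using assms unfolding ReV_iff_nucleus by blast
  then show "l 1 (l 2 (l 3 x)) = - x" "l 1 (l 4 (l 5 x)) = - x" "l 2 (l 4 (l 6 x)) = - x"
    by (simp_all add: l_def omult_table obasis_0 L_simps' flip: \<open>\<And>p q. L (omult p q) x = L p (L q x)\<close>)
qed

lemma real_proj_l:
  assumes "x \<in> ReV L R" "i < 8"
  shows "real_proj (l i x) = (if i = 0 then x else 0)"
proof -
  note trip = quaternion_triple_obasis
  have l3: "l 3 x = l 1 (l 2 x)" and l5: "l 5 x = l 1 (l 4 x)" and l6: "l 6 x = l 2 (l 4 x)"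
    using L_triple_neg[OF trip(1)] L_triple_neg[OF trip(2)] L_triple_neg[OF trip(4)] ReV_tau[OF assms(1)]
    by (simp_all add: l_def)
  have "L (obasis 3) (L (obasis 4) x) = L (omult (obasis 3) (obasis 4)) x"
    using assms(1) unfolding ReV_iff_nucleus by metis
  then have l7: "l 7 x = - l 1 (l 2 (l 4 x))"
    by (simp add: omult_table l_def[symmetric] l3[symmetric]) (simp add: l_simps l3)
  have "\<forall>i<8. real_proj (l i x) = (if i = 0 then x else 0)"
    unfolding all_lt8 by (simp add: real_proj_def l_0 l_simps l3 l5 l6 l7 scaleR_add_right scaleR_add_left[symmetric])
  then show ?thesis using assms(2) by blast
qed

lemma R_eq_L: "v \<in> ReV L R \<Longrightarrow> R v p = L p v"
  unfolding ReV_def by simp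

lemma ReV_L_L: "v \<in> ReV L R \<Longrightarrow> L p (L q v) = L (omult p q) v"
  unfolding ReV_iff_nucleus by simp

lemma ReV_R_R: "v \<in> ReV L R \<Longrightarrow> R (R v p) q = R v (omult p q)"
  using assoc_right[of v p q] by (simp add: ReV_L_L)

lemma ReV_L_R: "v \<in> ReV L R \<Longrightarrow> L q (R v p) = R v (omult q p)"
  by (simp add: R_eq_L ReV_L_L)

lemma subspace_ReV: "subspace (ReV L R)"
  by (auto simp: subspace_def ReV_iff_nucleus L_simps)

lemma real_proj_R:
  assumes "v \<in> ReV L R"
  shows "real_proj (R v p) = inner p oone *\<^sub>R v"
proof (rule linear_eq_obasis[where f = "\<lambda>p. real_proj (R v p)"])
  show "linear (\<lambda>p. real_proj (R v p))"
    using linear_compose[OF linear_R' linear_real_proj] by (simp add: o_def)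
  show "linear (\<lambda>p. inner p oone *\<^sub>R v)"
    by (simp add: linear_iff inner_add_left scaleR_add_left)
  fix i :: nat assume "i < 8"
  then show "real_proj (R v (obasis i)) = inner (obasis i) oone *\<^sub>R v"
    using real_proj_l[OF assms, of i] inner_obasis[of i 0] by (simp add: R_eq_L assms l_def obasis_0)
qed

lemma inner_omult_obasis:
  "i < 8 \<Longrightarrow> inner (omult (obasis i) p) oone = (if i = 0 then inner p oone else - inner p (obasis i))"
proof -
  have "\<forall>i<8. inner (omult (obasis i) p) oone = (if i = 0 then inner p oone else - inner p (obasis i))"
    unfolding all_lt8 by (simp add: obasis_omult inner_prod_def inner_complex_def)
  then show "i < 8 \<Longrightarrow> ?thesis" by blast
qed

lemma real_proj_l_R:
  assumes "v \<in> ReV L R" "i < 8"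
  shows "real_proj (l i (R v p)) = (if i = 0 then inner p oone else - inner p (obasis i)) *\<^sub>R v"
  using assms by (simp add: l_def ReV_L_R real_proj_R inner_omult_obasis)

definition real_comp :: "'v \<Rightarrow> nat \<Rightarrow> 'v" where
  "real_comp x i = (if i = 0 then real_proj x else if i < 8 then - real_proj (l i x) else 0)"

lemma real_comp_ReV: "real_comp x i \<in> ReV L R"
  using real_proj_ReV subspace_ReV by (auto simp: real_comp_def subspace_neg subspace_0)

lemma real_comp_expand: "(\<Sum>i<8. R (real_comp x i) (obasis i)) = x"
proof -
  have "{..<8} = insert 0 {1..<8::nat}" by auto
  then have "(\<Sum>i<8. R (real_comp x i) (obasis i))
      = real_proj x + (\<Sum>i\<in>{1..<8}. R (real_comp x i) (obasis i))"
    by (simp add: obasis_0 real_comp_def)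
  also have "(\<Sum>i\<in>{1..<8}. R (real_comp x i) (obasis i)) = (\<Sum>i\<in>{1..<8}. - l i (real_proj (l i x)))"
    by (rule sum.cong) (simp_all add: real_comp_def R_simps R_eq_L[OF real_proj_ReV] l_def)
  also have "real_proj x + \<dots> = x"
    using real_proj_expand[of x] by (simp add: sum_negf)
  finally show ?thesis .
qed

lemma ocomp_eq: "ocomp L R x = real_comp x"
  unfolding ocomp_def
proof (rule the_equality)
  show "(\<forall>i<8. real_comp x i \<in> ReV L R) \<and> (\<forall>i\<ge>8. real_comp x i = 0)
      \<and> x = (\<Sum>i<8. R (real_comp x i) (obasis i))"
    using real_comp_ReV real_comp_expand[of x] by (simp add: real_comp_def)
next
  fix c assume c: "(\<forall>i<8. c i \<in> ReV L R) \<and> (\<forall>i\<ge>8. c i = 0) \<and> x = (\<Sum>i<8. R (c i) (obasis i))"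
  have "real_proj (l i x) = (if i = 0 then c 0 else - c i)" if "i < 8" for i
  proof -
    have "real_proj (l i x) = (\<Sum>j<8. real_proj (l i (R (c j) (obasis j))))"
      using c by (simp add: l_def linear_sum[OF linear_L] linear_sum[OF linear_real_proj])
    also have "\<dots> = (\<Sum>j<8. if j = i then (if i = 0 then c j else - c j) else 0)"
      using c that by (intro sum.cong)
        (auto simp: real_proj_l_R inner_obasis inner_obasis[where j = 0, unfolded obasis_0])
    also have "\<dots> = (if i = 0 then c 0 else - c i)"
      using that by simp
    finally show ?thesis .
  qed
  note this[of 0] this
  with c show "c = real_comp x" by (intro ext) (simp add: real_comp_def l_0 not_less)
qed

lemma ocomp_ReV: "ocomp L R x i \<in> ReV L R"
  by (simp add: ocomp_eq real_comp_ReV)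

lemma ocomp_expand: "(\<Sum>i<8. R (ocomp L R x i) (obasis i)) = x"
  by (simp add: ocomp_eq real_comp_expand)

lemma ocomp_R: "v \<in> ReV L R \<Longrightarrow> i < 8 \<Longrightarrow> ocomp L R (R v p) i = inner p (obasis i) *\<^sub>R v"
  using real_proj_l_R[of v i p] real_proj_R[of v p] by (simp add: ocomp_eq real_comp_def obasis_0)

lemma linear_ocomp: "linear (\<lambda>x. ocomp L R x i)"
  unfolding linear_iff ocomp_eq real_comp_def
  by (simp add: l_linear linear_add[OF linear_real_proj] linear_cmul[OF linear_real_proj])

lemma oct_decomp_eqI:
  assumes "linear f" "linear g"
    and "\<And>v i. v \<in> ReV L R \<Longrightarrow> i < 8 \<Longrightarrow> f (R v (obasis i)) = g (R v (obasis i))"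
  shows "f x = g x"
proof -
  have "f (\<Sum>i<8. R (ocomp L R x i) (obasis i)) = g (\<Sum>i<8. R (ocomp L R x i) (obasis i))"
    by (simp only: linear_sum[OF assms(1)] linear_sum[OF assms(2)]) (simp add: assms(3) ocomp_ReV)
  then show ?thesis by (simp only: ocomp_expand)
qed

lemma linear_ReP: "linear (ReP L R)"
  using linear_ocomp[of 0] by (simp add: ReP_def[abs_def])

lemma ReP_R: "v \<in> ReV L R \<Longrightarrow> ReP L R (R v p) = inner p oone *\<^sub>R v"
  using ocomp_R[of v 0 p] by (simp add: ReP_def obasis_0)

lemma ReP_assoc: "ReP L R (R (R y p) q) = ReP L R (R y (omult p q))"
proof (rule oct_decomp_eqI[where f = "\<lambda>y. ReP L R (R (R y p) q)"])
  show "linear (\<lambda>y. ReP L R (R (R y p) q))" "linear (\<lambda>y. ReP L R (R y (omult p q)))"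
    by (simp_all add: linear_iff R_simps linear_add[OF linear_ReP] linear_cmul[OF linear_ReP])
qed (simp add: ReV_R_R ReP_R inner_oone_assoc)

lemma ocomp_ReP: "i < 8 \<Longrightarrow> ocomp L R y i = ReP L R (R y (oconj (obasis i)))"
proof (rule oct_decomp_eqI[where f = "\<lambda>y. ocomp L R y i"])
  show "linear (\<lambda>y. ReP L R (R y (oconj (obasis i))))"
    by (simp add: linear_iff R_simps linear_add[OF linear_ReP] linear_cmul[OF linear_ReP])
qed (simp_all add: linear_ocomp ocomp_R ReV_R_R ReP_R inner_oone_oconj)

lemma eq_if_ReP_eq:
  assumes "\<And>q. ReP L R (R x q) = ReP L R (R y q)"
  shows "x = y"
proof -
  have "(\<Sum>i<8. R (ocomp L R x i) (obasis i)) = (\<Sum>i<8. R (ocomp L R y i) (obasis i))"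
    by (rule sum.cong) (simp_all add: ocomp_ReP assms)
  then show ?thesis by (simp only: ocomp_expand)
qed

lemma C_J_assoc:
  assumes "J \<in> osphere"
  shows "R (R x (cJ J z)) (cJ J w) = R x (cJ J (z * w))"
proof -
  have "R (R x J) J = - x" using R_square[of x J] assms by (simp add: osphere_def R_simps')
  then show ?thesis
    by (simp add: cJ_def R_simps R_simps' algebra_simps)
qed

lemma associator_alt: "R y (omult p q) - (R (R y q) p - R y (omult q p)) = R (R y p) q"
proof -
  have "R (R y p) q - R y (omult p q) = - (R (R y q) p - R y (omult q p))"
    unfolding assoc_right by (rule assoc_flip)
  then have "R (R y p) q = R y (omult p q) + - (R (R y q) p - R y (omult q p))"
    by (metis diff_add_cancel add.commute)
  then show ?thesis by simp
qed

end
section \<open>Contour integrals over Jordan curves\<close>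

lemma holomorphic_loops_contour_integral_eq:
  assumes "open S" "f holomorphic_on S"
    and g: "valid_path g" "pathfinish g = pathstart g" "path_image g \<subseteq> S"
    and h: "valid_path h" "pathfinish h = pathstart h" "path_image h \<subseteq> S"
    and p: "valid_path p" "pathstart p = pathstart g" "pathfinish p = pathstart h" "path_image p \<subseteq> S"
    and wind: "\<And>z. z \<notin> S \<Longrightarrow> winding_number g z = winding_number h z"
  shows "contour_integral g f = contour_integral h f"
proof -
  define q where "q = g +++ p +++ reversepath h +++ reversepath p"
  have int: "f contour_integrable_on \<gamma>" if "valid_path \<gamma>" "path_image \<gamma> \<subseteq> S" for \<gamma>
    using contour_integrable_holomorphic_simple[OF assms(2,1) that] .
  have q: "valid_path q" "pathfinish q = pathstart q" "path_image q \<subseteq> S"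
    using g h p by (simp_all add: q_def valid_path_join path_image_join path_image_reversepath)
  have "winding_number q z = 0" if "z \<notin> S" for z
  proof -
    have z: "z \<notin> path_image g" "z \<notin> path_image h" "z \<notin> path_image p"
      using that g h p by auto
    then have "winding_number q z = winding_number g z + (winding_number p z
        + (winding_number (reversepath h) z + winding_number (reversepath p) z))"
      unfolding q_def using g h p
      by (simp add: winding_number_join valid_path_imp_path path_image_join path_image_reversepath
          not_in_path_image_join)
    then show ?thesis
      using wind[OF that] z g h p
      by (simp add: winding_number_reversepath valid_path_imp_path)
  qed
  then have "(f has_contour_integral 0) q"
    using Cauchy_theorem_global[OF assms(1,2) q(1,2,3)] by blast
  then have "contour_integral q f = 0" by (rule contour_integral_unique)
  moreover have "contour_integral q f = contour_integral g f + (contour_integral p f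
      + (contour_integral (reversepath h) f + contour_integral (reversepath p) f))"
    unfolding q_def using g h p int
    by (simp add: contour_integral_join contour_integrable_join contour_integrable_reversepath
        path_image_join path_image_reversepath valid_path_join)
  ultimately show ?thesis
    using g h p int by (simp add: contour_integral_reversepath)
qed

lemma connected_disjoint_Jordan:
  fixes g :: "real \<Rightarrow> complex"
  assumes g: "simple_path g" "pathfinish g = pathstart g"
    and D: "connected D" "D \<inter> path_image g = {}"
  shows "D \<subseteq> inside (path_image g) \<or> D \<subseteq> outside (path_image g)"
proof -
  have "D \<subseteq> inside (path_image g) \<union> outside (path_image g)"
    using D(2) by (simp add: inside_Un_outside disjoint_eq_subset_Compl)
  moreover have "open (inside (path_image g))" "open (outside (path_image g))"
    using g by (simp_all add: open_inside open_outside closed_path_image simple_path_imp_path)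
  moreover have "inside (path_image g) \<inter> outside (path_image g) \<inter> D = {}" by auto
  ultimately show ?thesis
    using connectedD[OF D(1), of "inside (path_image g)" "outside (path_image g)"] by blast
qed

lemma Jordan_nonreal_points_dense:
  assumes D: "open D" "connected D" and sym: "\<And>z. z \<in> D \<Longrightarrow> cnj z \<in> D"
    and g: "simple_path g" "pathfinish g = pathstart g" "path_image g \<subseteq> frontier D"
    and s: "s \<in> path_image g" "Im s = 0" and "e > 0"
  shows "\<exists>z\<in>path_image g. z \<in> ball s e \<and> Im z \<noteq> 0"
proof (rule ccontr)
  assume "\<not> ?thesis"
  then have real: "Im z = 0" if "z \<in> path_image g" "z \<in> ball s e" for z using that by blast
  define P where "P = path_image g"
  define Up where "Up = ball s e \<inter> {z. Im z > 0}"
  define Lo where "Lo = ball s e \<inter> {z. Im z < 0}"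
  have conn: "connected Up" "connected Lo"
    unfolding Up_def Lo_def
    by (auto intro!: convex_connected convex_Int convex_halfspace_Im_gt convex_halfspace_Im_lt)
  have disj: "Up \<inter> P = {}" "Lo \<inter> P = {}"
    using real by (force simp: Up_def Lo_def P_def)+
  have nonreal: "\<exists>z\<in>X. z \<in> Up \<union> Lo" if "open X" "s \<in> closure X" for X
  proof -
    obtain x where "x \<in> X" "dist x s < e"
      using \<open>s \<in> closure X\<close> \<open>e > 0\<close> closure_approachable by blast
    then have "open (X \<inter> ball s e)" "x \<in> X \<inter> ball s e"
      using \<open>open X\<close> by (auto simp: dist_commute)
    then obtain d where "d > 0" and d: "ball x d \<subseteq> X \<inter> ball s e"
      using open_contains_ball by blast
    define y where "y = (if Im x = 0 then x + \<i> * of_real (d / 2) else x)"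
    have "y \<in> ball x d" "Im y \<noteq> 0"
      using \<open>d > 0\<close> by (auto simp: y_def dist_norm norm_mult)
    with d show ?thesis by (intro bexI[of _ y]) (auto simp: Up_def Lo_def)
  qed
  have io: "open (inside P)" "open (outside P)" "s \<in> closure (inside P)" "s \<in> closure (outside P)"
    using Jordan_inside_outside[OF g(1,2)] s(1) unfolding P_def by (auto simp: frontier_def)
  have sub: "X \<subseteq> inside P \<or> X \<subseteq> outside P" if "connected X" "X \<inter> P = {}" for X
    using connected_disjoint_Jordan[OF g(1,2) that(1)] that(2) by (simp add: P_def)
  have sides: "Up \<subseteq> inside P \<and> Lo \<subseteq> outside P \<or> Up \<subseteq> outside P \<and> Lo \<subseteq> inside P"
    using sub[OF conn(1) disj(1)] sub[OF conn(2) disj(2)] nonreal[OF io(1,3)] nonreal[OF io(2,4)]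
      inside_Int_outside[of P] by blast
  have "s \<in> closure D" using g(3) s(1) by (auto simp: frontier_def)
  then obtain z where z: "z \<in> D" "z \<in> Up \<union> Lo" using nonreal[OF D(1)] by blast
  have "cnj z \<in> D" using sym z(1) by blast
  moreover have "cnj s = s" using s(2) by (simp add: complex_eq_iff)
  then have "dist s (cnj w) = dist s w" for w
    using complex_mod_cnj[of "s - w"] by (simp add: dist_norm)
  then have "z \<in> Up \<longrightarrow> cnj z \<in> Lo" "z \<in> Lo \<longrightarrow> cnj z \<in> Up"
    by (simp_all add: Up_def Lo_def)
  moreover have "D \<inter> P = {}"
    using g(3) D(1) by (auto simp: P_def frontier_def interior_open)
  ultimately show False
    using sub[OF D(2)] sides z inside_Int_outside[of P] by blast
qed

lemma Jordan_contour_integral_circlepath: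
  assumes D: "connected D" "z0 \<in> D" "D \<inter> path_image g = {}"
    and g: "valid_path g" "simple_path g" "pathfinish g = pathstart g"
    and S: "open S" "- D \<subseteq> S" "f holomorphic_on S"
    and r: "D \<union> path_image g \<subseteq> ball 0 r" "r > 0"
  shows "contour_integral g f = winding_number g z0 * contour_integral (circlepath 0 r) f"
proof -
  define P where "P = path_image g"
  have gS: "P \<subseteq> S" using D(3) S(2) by (auto simp: P_def)
  have path: "path g" using g(1) valid_path_imp_path by blast
  have circ: "path_image (circlepath 0 r) \<subseteq> S"
  proof
    fix z :: complex assume "z \<in> path_image (circlepath 0 r)"
    then have "z \<notin> ball 0 r" using r(2) by (auto simp: dist_norm)
    then show "z \<in> S" using r(1) S(2) by blast
  qed
  consider "D \<subseteq> outside P" | "D \<subseteq> inside P"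
    using connected_disjoint_Jordan[OF g(2,3) D(1,3)] by (auto simp: P_def)
  then show ?thesis
  proof cases
    case 1
    then have w: "winding_number g z = 0" if "z \<in> D" for z
      using winding_number_zero_in_outside[OF path g(3)] that by (auto simp: P_def)
    have "(f has_contour_integral 0) g"
      by (rule Cauchy_theorem_global[OF S(1,3) g(1,3)]) (use gS S(2) w in \<open>auto simp: P_def\<close>)
    then show ?thesis using w[OF D(2)] contour_integral_unique by auto
  next
    case 2
    obtain n :: complex where n: "n = 1 \<or> n = -1" "\<And>z. z \<in> inside P \<Longrightarrow> winding_number g z = n"
      using simple_closed_path_winding_number_inside[OF g(2)] g(3) unfolding P_def by metis
    define h where "h = (if n = 1 then circlepath 0 r else reversepath (circlepath 0 r))"
    have h: "valid_path h" "pathfinish h = pathstart h" "path_image h \<subseteq> S" "pathstart h = of_real r"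
      using circ by (auto simp: h_def)
    have conn: "connected (closure (outside P))"
      using Jordan_inside_outside[OF g(2,3)] by (simp add: P_def connected_imp_connected_closure)
    have "closure (outside P) \<inter> D = {}"
    proof -
      have "open (inside P)" using path g by (simp add: P_def open_inside closed_path_image)
      then have "closure (outside P) \<inter> inside P = {}"
        by (metis inside_Int_outside open_Int_closure_eq_empty Int_commute)
      then show ?thesis using 2 by blast
    qed
    then have CS: "closure (outside P) \<subseteq> S" using S(2) by blast
    have start: "pathstart g \<in> closure (outside P)"
      using Jordan_inside_outside[OF g(2,3)] pathstart_in_path_image[of g]
      by (auto simp: P_def frontier_def)
    have "- ball 0 r \<subseteq> outside P"
      using r(1) by (intro outside_subset_convex) (auto simp: P_def)
    then have r_out: "of_real r \<in> closure (outside P)"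
      using r(2) closure_subset by (force simp: dist_norm)
    define T where "T = connected_component_set S (pathstart g)"
    have T: "open T" "connected T" "T \<subseteq> S"
      using S(1) by (simp_all add: T_def open_connected_component connected_component_subset)
    have "closure (outside P) \<subseteq> T"
      unfolding T_def by (rule connected_component_maximal[OF start conn CS])
    then obtain p where "polynomial_function p" "path_image p \<subseteq> T" "pathstart p = pathstart g"
        "pathfinish p = of_real r"
      using connected_open_polynomial_connected[OF T(1,2)] start r_out by blast
    then have p: "valid_path p" "pathstart p = pathstart g" "pathfinish p = pathstart h" "path_image p \<subseteq> S"
      using T(3) h(4) by (auto simp: valid_path_polynomial_function)
    have "winding_number g z = winding_number h z" if "z \<notin> S" for z
    proof -
      have z: "z \<in> D" using that S(2) by blast
      then have "winding_number (circlepath 0 r) z = 1"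
        using r(1) by (intro winding_number_circlepath) (auto simp: dist_norm)
      moreover have "z \<notin> path_image (circlepath 0 r)" using circ that by blast
      ultimately have "winding_number h z = n"
        using n(1) by (auto simp: h_def winding_number_reversepath)
      then show ?thesis using n(2) z 2 by auto
    qed
    from holomorphic_loops_contour_integral_eq[OF S(1,3) g(1,3) _ h(1,2,3) p this]
    have "contour_integral g f = contour_integral h f" using gS by (simp add: P_def)
    also have "\<dots> = n * contour_integral (circlepath 0 r) f"
      using n(1) by (auto simp: h_def contour_integral_reversepath)
    finally show ?thesis using n(2) 2 D(2) by auto
  qed
qed

section \<open>Bounded functionals separate points\<close>

definition sublinear :: "('a::real_vector \<Rightarrow> real) \<Rightarrow> bool" where
  "sublinear p \<longleftrightarrow> (\<forall>x y. p (x + y) \<le> p x + p y) \<and> (\<forall>c x. c \<ge> 0 \<longrightarrow> p (c *\<^sub>R x) = c * p x)"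

lemma sublinear_add: "sublinear p \<Longrightarrow> p (x + y) \<le> p x + p y"
  and sublinear_scaleR: "sublinear p \<Longrightarrow> c \<ge> 0 \<Longrightarrow> p (c *\<^sub>R x) = c * p x"
  by (simp_all add: sublinear_def)

lemma sublinear_zero: "sublinear p \<Longrightarrow> p 0 = 0"
  using sublinear_scaleR[of p 0 0] by simp

lemma sublinear_minus: "sublinear p \<Longrightarrow> - p (- x) \<le> p x"
  using sublinear_add[of p x "- x"] sublinear_zero[of p] by simp

text \<open>For a minimal p this q equals p, whence p (- y) = - p y.\<close>
lemma sublinear_shift:
  fixes p :: "'a::real_vector \<Rightarrow> real"
  assumes p: "sublinear p"
  obtains q where "sublinear q" "\<And>x. q x \<le> p x" "q (- y) \<le> - p y"
proof -
  define F where "F x = (\<lambda>t. p (x + t *\<^sub>R y) - t * p y) ` {0..}" for x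
  define q where "q x = Inf (F x)" for x
  have lower: "- p (- x) \<le> p (x + t *\<^sub>R y) - t * p y" if "t \<ge> 0" for x t
    using sublinear_add[OF p, of "x + t *\<^sub>R y" "- x"] sublinear_scaleR[OF p that, of y] by simp
  have bdd: "bdd_below (F x)" for x
    unfolding F_def by (rule bdd_belowI2[where m = "- p (- x)"]) (simp add: lower)
  have ne: "F x \<noteq> {}" for x by (simp add: F_def)
  have q_le: "q x \<le> p (x + t *\<^sub>R y) - t * p y" if "t \<ge> 0" for x t
    unfolding q_def using bdd that by (intro cInf_lower) (auto simp: F_def)
  have q_ge: "c \<le> q x" if "\<And>t. t \<ge> 0 \<Longrightarrow> c \<le> p (x + t *\<^sub>R y) - t * p y" for c x
    unfolding q_def using ne that by (intro cInf_greatest) (auto simp: F_def)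
  have "q (x + z) \<le> q x + q z" for x z
  proof -
    have "q (x + z) - (p (x + t *\<^sub>R y) - t * p y) \<le> p (z + u *\<^sub>R y) - u * p y" if "t \<ge> 0" "u \<ge> 0" for t u
      using q_le[of "t + u" "x + z"] that sublinear_add[OF p, of "x + t *\<^sub>R y" "z + u *\<^sub>R y"]
      by (simp add: algebra_simps)
    then have "q (x + z) - (p (x + t *\<^sub>R y) - t * p y) \<le> q z" if "t \<ge> 0" for t
      using that q_ge by blast
    then have "q (x + z) - q z \<le> q x"
      by (intro q_ge) (simp add: algebra_simps)
    then show ?thesis by simp
  qed
  moreover have "q (c *\<^sub>R x) = c * q x" if c: "c > 0" for c x
  proof (rule antisym)
    have "q (c *\<^sub>R x) / c \<le> p (x + t *\<^sub>R y) - t * p y" if "t \<ge> 0" for t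
      using q_le[of "c * t" "c *\<^sub>R x"] c that sublinear_scaleR[OF p, of c "x + t *\<^sub>R y"]
      by (simp add: field_simps scaleR_add_right)
    then have "q (c *\<^sub>R x) / c \<le> q x" by (rule q_ge)
    then show "q (c *\<^sub>R x) \<le> c * q x" using c by (simp add: field_simps)
    show "c * q x \<le> q (c *\<^sub>R x)"
    proof (rule q_ge)
      fix t :: real assume "t \<ge> 0"
      then show "c * q x \<le> p (c *\<^sub>R x + t *\<^sub>R y) - t * p y"
        using q_le[of "t / c" x] c sublinear_scaleR[OF p, of c "x + (t / c) *\<^sub>R y"]
        by (simp add: field_simps scaleR_add_right)
    qed
  qed
  moreover have "q 0 = 0"
    using q_le[of 0 0] q_ge[of 0 0] sublinear_scaleR[OF p, of _ y] sublinear_zero[OF p]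
    by (intro antisym) auto
  ultimately have "sublinear q"
    unfolding sublinear_def by (metis less_eq_real_def mult_zero_left scaleR_zero_left)
  moreover have "q x \<le> p x" for x using q_le[of 0 x] by simp
  moreover have "q (- y) \<le> - p y" using q_le[of 1 "- y"] sublinear_zero[OF p] by simp
  ultimately show ?thesis by (rule that)
qed

lemma sublinear_Inf_chain:
  fixes C :: "('a::real_vector \<Rightarrow> real) set"
  assumes "C \<noteq> {}" and sub: "\<And>p. p \<in> C \<Longrightarrow> sublinear p"
    and chain: "\<And>p q. p \<in> C \<Longrightarrow> q \<in> C \<Longrightarrow> p \<le> q \<or> q \<le> p"
    and bound: "\<forall>p\<in>C. \<forall>x. p x \<le> b x"
  shows "sublinear (\<lambda>x. INF p\<in>C. p x)" "p \<in> C \<Longrightarrow> (INF p\<in>C. p x) \<le> p x"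
proof -
  have bdd: "bdd_below ((\<lambda>p. p x) ` C)" for x
  proof (rule bdd_belowI2)
    fix p assume "p \<in> C"
    then show "- b (- x) \<le> p x"
      using sublinear_minus[OF sub, of p x] bound[rule_format, of p "- x"] by linarith
  qed
  show lower: "(INF p\<in>C. p x) \<le> p x" if "p \<in> C" for p x
    using bdd that by (rule cINF_lower)
  show "sublinear (\<lambda>x. INF p\<in>C. p x)"
    unfolding sublinear_def
  proof (intro conjI allI impI)
    fix x y
    have "(INF p\<in>C. p (x + y)) - q x \<le> p y" if pq: "p \<in> C" "q \<in> C" for p q
    proof -
      obtain r where r: "r \<in> C" "r \<le> p" "r \<le> q"
        using chain[OF pq] pq by (metis order_refl)
      then show ?thesis
        using lower[of r "x + y"] sublinear_add[OF sub[OF r(1)], of x y] le_funD[OF r(2), of y] le_funD[OF r(3), of x]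
        by linarith
    qed
    then have "(INF p\<in>C. p (x + y)) - q x \<le> (INF p\<in>C. p y)" if "q \<in> C" for q
      using that \<open>C \<noteq> {}\<close> by (intro cINF_greatest) auto
    then have "(INF p\<in>C. p (x + y)) - (INF p\<in>C. p y) \<le> (INF p\<in>C. p x)"
      using \<open>C \<noteq> {}\<close> by (intro cINF_greatest) (auto simp: algebra_simps)
    then show "(INF p\<in>C. p (x + y)) \<le> (INF p\<in>C. p x) + (INF p\<in>C. p y)" by simp
  next
    fix c :: real and x :: 'a assume "c \<ge> 0"
    show "(INF p\<in>C. p (c *\<^sub>R x)) = c * (INF p\<in>C. p x)"
    proof (cases "c = 0")
      case True
      have "(\<lambda>p. p 0) ` C = {0}" using \<open>C \<noteq> {}\<close> sublinear_zero[OF sub] by (force simp: image_iff)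
      then show ?thesis using True by simp
    next
      case False
      with \<open>c \<ge> 0\<close> have c: "c > 0" by simp
      have le: "(INF p\<in>C. p (d *\<^sub>R y)) \<le> d * (INF p\<in>C. p y)" if d: "d > 0" for d y
      proof -
        have "(INF p\<in>C. p (d *\<^sub>R y)) / d \<le> (INF p\<in>C. p y)"
          using \<open>C \<noteq> {}\<close> lower[of _ "d *\<^sub>R y"] d sublinear_scaleR[OF sub, of _ d y]
          by (intro cINF_greatest) (auto simp: field_simps)
        then show ?thesis using d by (simp add: field_simps)
      qed
      show ?thesis
        using le[OF c, of x] le[of "1 / c" "c *\<^sub>R x"] c
        by (intro antisym) (auto simp: field_simps)
    qed
  qed
qed

lemma minimal_sublinear_linear:
  fixes p :: "'a::real_vector \<Rightarrow> real"
  assumes p: "sublinear p" and min: "\<And>q. sublinear q \<Longrightarrow> q \<le> p \<Longrightarrow> q = p"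
  shows "linear p"
proof -
  have neg: "p (- y) = - p y" for y
  proof -
    obtain q where q: "sublinear q" "\<And>x. q x \<le> p x" "q (- y) \<le> - p y"
      using sublinear_shift[OF p] by blast
    then have "q = p" by (intro min) (auto simp: le_fun_def)
    with q(3) sublinear_minus[OF p, of y] show ?thesis by simp
  qed
  have "p (x + y) = p x + p y" for x y
    using sublinear_add[OF p, of x y] sublinear_add[OF p, of "x + y" "- y"] neg[of y] by simp
  moreover have "p (c *\<^sub>R x) = c * p x" for c x
    using sublinear_scaleR[OF p, of c x] sublinear_scaleR[OF p, of "- c" x] neg[of "c *\<^sub>R x"]
    by (cases "c \<ge> 0") auto
  ultimately show ?thesis by (intro linearI) auto
qed

lemma ex_linear_le_sublinear:
  fixes p :: "'a::real_vector \<Rightarrow> real"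
  assumes "sublinear p"
  shows "\<exists>f. linear f \<and> (\<forall>x. f x \<le> p x)"
proof -
  define A where "A = {q. sublinear q \<and> q \<le> p}"
  define r where "r = {(a, b). a \<in> A \<and> b \<in> A \<and> b \<le> a}"
  have "Partial_order r"
    by (auto simp: r_def partial_order_on_def preorder_on_def refl_on_def trans_def antisym_def Field_def)
  moreover have "\<exists>u\<in>Field r. \<forall>a\<in>C. (a, u) \<in> r" if "C \<in> Chains r" for C
  proof (cases "C = {}")
    case True
    then show ?thesis using assms by (auto simp: r_def A_def Field_def)
  next
    case False
    have C: "sublinear q" "q \<le> p" if "q \<in> C" for q
      using \<open>C \<in> Chains r\<close> that by (auto simp: Chains_def r_def A_def)
    have ch: "q \<le> q' \<or> q' \<le> q" if "q \<in> C" "q' \<in> C" for q q'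
      using \<open>C \<in> Chains r\<close> that by (auto simp: Chains_def r_def)
    have bnd: "\<forall>q\<in>C. \<forall>x. q x \<le> p x" using C(2) by (simp add: le_fun_def)
    note inf = sublinear_Inf_chain[OF False C(1) ch bnd]
    define u where "u = (\<lambda>x. INF q\<in>C. q x)"
    have u: "u \<le> q" if "q \<in> C" for q using inf(2)[OF _ _ _ that] that by (simp add: u_def le_fun_def)
    moreover have "sublinear u" using inf(1) by (simp add: u_def)
    moreover obtain q where "q \<in> C" using False by blast
    then have "u \<le> p" using u C(2) order_trans by blast
    ultimately have "\<forall>a\<in>C. (a, u) \<in> r"
      using C by (auto simp: r_def A_def)
    moreover have "u \<in> Field r" using \<open>sublinear u\<close> \<open>u \<le> p\<close> by (auto simp: r_def A_def Field_def)
    ultimately show ?thesis by blast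
  qed
  ultimately obtain m where m: "m \<in> Field r" "\<And>a. a \<in> Field r \<Longrightarrow> (m, a) \<in> r \<Longrightarrow> a = m"
    using Zorns_po_lemma[of r] by blast
  have mA: "m \<in> A" using m(1) by (auto simp: r_def Field_def)
  have "linear m"
  proof (rule minimal_sublinear_linear)
    fix q assume q: "sublinear q" "q \<le> m"
    then have "q \<in> A" using mA by (auto simp: A_def)
    with q mA show "q = m" by (intro m(2)) (auto simp: r_def Field_def)
  qed (use mA in \<open>simp add: A_def\<close>)
  then show ?thesis using mA by (auto simp: A_def le_fun_def)
qed

lemma ex_bounded_linear_functional:
  fixes x :: "'a::real_normed_vector"
  assumes "x \<noteq> 0"
  shows "\<exists>f :: 'a \<Rightarrow> real. bounded_linear f \<and> f x \<noteq> 0"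
proof -
  have norm: "sublinear (norm :: 'a \<Rightarrow> real)"
    by (simp add: sublinear_def norm_triangle_ineq)
  obtain q :: "'a \<Rightarrow> real" where q: "sublinear q" "\<And>y. q y \<le> norm y" "q (- x) \<le> - norm x"
    using sublinear_shift[OF norm] by blast
  obtain f where f: "linear f" "\<And>y. f y \<le> q y" using ex_linear_le_sublinear[OF q(1)] by blast
  have le: "f y \<le> norm y" for y using f(2) q(2) order_trans by blast
  have "bounded_linear f"
    using le[of "- _"] le linear_neg[OF f(1)]
    by (intro bounded_linear_intro[where K = 1])
      (auto simp: linear_add[OF f(1)] linear_cmul[OF f(1)] abs_le_iff)
  moreover have "norm x > 0" using assms by simp
  then have "f x \<noteq> 0"
    using f(2)[of "- x"] q(3) linear_neg[OF f(1), of x] by linarith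
  ultimately show ?thesis by blast
qed

section \<open>Integrals along paths with values in a Banach space\<close>

lemma power_series_summable:
  fixes c :: "nat \<Rightarrow> complex \<Rightarrow> 'e::banach"
  assumes bound: "\<And>k w. norm (c k w) \<le> K * M ^ k * norm w" and "M > 0" "K \<ge> 0" "M * r < 1"
    and d: "norm d < r"
  shows "summable (\<lambda>k. c k (d ^ k * w))"
    and "norm ((\<Sum>k<n. c k (d ^ k * w)) - (\<Sum>k. c k (d ^ k * w))) \<le> K / (1 - M * r) * (M * r) ^ n * norm w"
proof -
  define q where "q = M * r"
  have "r > 0" using d norm_ge_zero[of d] by linarith
  then have q: "0 < q" "q < 1" using assms by (simp_all add: q_def)
  have le: "norm (c k (d ^ k * w)) \<le> K * norm w * q ^ k" for k
  proof -
    have "norm (c k (d ^ k * w)) \<le> K * M ^ k * (norm d ^ k * norm w)"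
      using bound[of k "d ^ k * w"] by (simp add: norm_mult norm_power)
    also have "\<dots> \<le> K * M ^ k * (r ^ k * norm w)"
      using d assms by (intro mult_left_mono mult_right_mono power_mono) auto
    finally show ?thesis by (simp add: q_def power_mult_distrib mult_ac)
  qed
  have geo: "summable (\<lambda>k. K * norm w * q ^ k)" using q by (intro summable_mult) simp
  show sum: "summable (\<lambda>k. c k (d ^ k * w))"
    by (rule summable_comparison_test'[OF geo]) (rule le)
  have geo': "summable (\<lambda>i. K * norm w * q ^ (i + n))"
    using geo by (subst summable_iff_shift)
  have "norm ((\<Sum>k<n. c k (d ^ k * w)) - (\<Sum>k. c k (d ^ k * w)))
      = norm (\<Sum>i. c (i + n) (d ^ (i + n) * w))"
    using suminf_split_initial_segment[OF sum, of n] by (simp add: norm_minus_commute)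
  also have "\<dots> \<le> (\<Sum>i. K * norm w * q ^ (i + n))"
    by (rule norm_suminf_le[OF le[of "_ + n"] geo'])
  also have "\<dots> = (\<Sum>i. (K * norm w * q ^ n) * q ^ i)"
    by (simp add: power_add mult_ac)
  also have "\<dots> = K * norm w * q ^ n * (1 / (1 - q))"
    using q by (subst suminf_mult) (auto simp: suminf_geometric)
  finally show "norm ((\<Sum>k<n. c k (d ^ k * w)) - (\<Sum>k. c k (d ^ k * w)))
      \<le> K / (1 - M * r) * (M * r) ^ n * norm w"
    by (simp add: q_def mult_ac)
qed

lemma power_series_primitive:
  fixes c :: "nat \<Rightarrow> complex \<Rightarrow> 'e::banach"
  assumes lin: "\<And>k. bounded_linear (c k)"
    and bound: "\<And>k w. norm (c k w) \<le> K * M ^ k * norm w" and M: "M > 0" "K \<ge> 0" "M * r < 1" "r > 0"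
  shows "\<exists>G. \<forall>z\<in>ball z0 r. (G has_derivative (\<lambda>w. \<Sum>k. c k ((z - z0) ^ k * w))) (at z)"
proof -
  define f where "f n z = c n ((z - z0) ^ Suc n / of_nat (Suc n))" for n z
  have "\<exists>G. \<forall>z\<in>ball z0 r. (\<lambda>n. f n z) sums G z \<and>
      (G has_derivative (\<lambda>w. \<Sum>k. c k ((z - z0) ^ k * w))) (at z within ball z0 r)"
  proof (rule has_derivative_series[where f' = "\<lambda>n z w. c n ((z - z0) ^ n * w)" and x = z0 and l = 0])
    fix n z
    have "((\<lambda>z. (z - z0) ^ Suc n) has_field_derivative of_nat (Suc n) * (z - z0) ^ n) (at z within ball z0 r)"
      using DERIV_power[OF DERIV_diff[OF DERIV_ident DERIV_const], where n = "Suc n"]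
      by (simp del: of_nat_Suc power_Suc)
    from DERIV_cdivide[OF this, of "of_nat (Suc n)"]
    have "((\<lambda>z. (z - z0) ^ Suc n / of_nat (Suc n)) has_field_derivative (z - z0) ^ n) (at z within ball z0 r)"
      by (simp del: of_nat_Suc power_Suc)
    then show "(f n has_derivative (\<lambda>w. c n ((z - z0) ^ n * w))) (at z within ball z0 r)"
      unfolding f_def has_field_derivative_def by (rule bounded_linear.has_derivative[OF lin])
  next
    fix e :: real assume "e > 0"
    have "(\<lambda>n. K / (1 - M * r) * (M * r) ^ n) \<longlonglongrightarrow> K / (1 - M * r) * 0"
      using M by (intro tendsto_mult tendsto_const LIMSEQ_realpow_zero) auto
    then have "\<forall>\<^sub>F n in sequentially. K / (1 - M * r) * (M * r) ^ n < e"
      using \<open>e > 0\<close> by (simp add: order_tendsto_iff)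
    then show "\<forall>\<^sub>F n in sequentially. \<forall>z\<in>ball z0 r. \<forall>h. norm ((\<Sum>i<n. c i ((z - z0) ^ i * h))
        - (\<Sum>k. c k ((z - z0) ^ k * h))) \<le> e * norm h"
    proof eventually_elim
      case (elim n)
      show ?case
      proof (intro ballI allI)
        fix z h assume "z \<in> ball z0 r"
        then have "norm (z - z0) < r" by (simp add: dist_norm norm_minus_commute)
        from power_series_summable(2)[OF bound M(1,2,3) this, where n = n and w = h]
        show "norm ((\<Sum>i<n. c i ((z - z0) ^ i * h)) - (\<Sum>k. c k ((z - z0) ^ k * h))) \<le> e * norm h"
          using elim by (meson less_imp_le mult_right_mono norm_ge_zero order_trans)
      qed
    qed
  next
    have "f n z0 = 0" for n using bounded_linear.linear[OF lin, of n] by (simp add: f_def linear_0)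
    then show "(\<lambda>n. f n z0) sums 0" by simp
  next
    show "convex (ball z0 r)" "z0 \<in> ball z0 r" using M(4) by simp_all
  qed
  then show ?thesis by (metis at_within_open open_ball)
qed

text \<open>A valid path may have an unbounded derivative near its exceptional points, so integrability does not
  follow from continuity of the integrand.\<close>
lemma integrable_on_path_if_local_primitive:
  fixes \<Phi> :: "complex \<Rightarrow> complex \<Rightarrow> 'e::banach"
  assumes g: "valid_path g"
    and prim: "\<And>z. z \<in> path_image g \<Longrightarrow>
      \<exists>r>0. \<exists>G. \<forall>w\<in>ball z r \<inter> path_image g. (G has_derivative \<Phi> w) (at w)"
  shows "(\<lambda>t. \<Phi> (g t) (vector_derivative g (at t))) integrable_on {0..1}"
proof -
  obtain S where S: "finite S" "g C1_differentiable_on {0..1} - S" and cont: "continuous_on {0..1} g"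
    using g unfolding valid_path_def piecewise_C1_differentiable_on_def by blast
  have deriv: "(g has_vector_derivative vector_derivative g (at t)) (at t)" if "t \<in> {0..1} - S" for t
    using S(2) that by (auto simp: C1_differentiable_on_eq vector_derivative_works)
  have "(\<lambda>t. \<Phi> (g t) (vector_derivative g (at t))) integrable_on cbox 0 1"
  proof (rule integrable_on_little_subintervals, intro ballI)
    fix t :: real assume t: "t \<in> cbox 0 1"
    then have "g t \<in> path_image g" by (auto simp: path_image_def)
    from prim[OF this] obtain r G where r: "r > 0"
      and G: "\<And>w. w \<in> ball (g t) r \<Longrightarrow> w \<in> path_image g \<Longrightarrow> (G has_derivative \<Phi> w) (at w)"
      by blast
    obtain d where "d > 0" and d: "\<And>s. s \<in> {0..1} \<Longrightarrow> dist s t < d \<Longrightarrow> dist (g s) (g t) < r"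
      using cont r box_real(2) t unfolding continuous_on_iff by metis
    show "\<exists>d>0. \<forall>u v. t \<in> cbox u v \<and> cbox u v \<subseteq> ball t d \<and> cbox u v \<subseteq> cbox 0 1 \<longrightarrow>
        (\<lambda>t. \<Phi> (g t) (vector_derivative g (at t))) integrable_on cbox u v"
    proof (intro exI[of _ d] conjI allI impI \<open>d > 0\<close>)
      fix u v assume uv: "t \<in> cbox u v \<and> cbox u v \<subseteq> ball t d \<and> cbox u v \<subseteq> cbox 0 1"
      have G': "(G has_derivative \<Phi> (g s)) (at (g s))" if "s \<in> {u..v}" for s
      proof (rule G)
        have "s \<in> {0..1}" "dist s t < d" using uv that by (auto simp: dist_commute)
        then show "g s \<in> ball (g t) r" "g s \<in> path_image g"
          using d by (auto simp: dist_commute path_image_def)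
      qed
      have sub: "{u..v} \<subseteq> {0..1}" "u \<le> v" using uv by auto
      have "((\<lambda>s. \<Phi> (g s) (vector_derivative g (at s))) has_integral (G \<circ> g) v - (G \<circ> g) u) {u..v}"
      proof (rule fundamental_theorem_of_calculus_interior_strong[OF S(1) sub(2)])
        fix s assume s: "s \<in> {u<..<v} - S"
        then have "(g has_vector_derivative vector_derivative g (at s)) (at s)"
          using sub by (intro deriv) auto
        then show "(G \<circ> g has_vector_derivative \<Phi> (g s) (vector_derivative g (at s))) (at s)"
          using G'[of s] s by (intro vector_derivative_diff_chain_within)
            (auto intro: has_derivative_at_withinI)
      next
        have "continuous (at (g s)) G" if "s \<in> {u..v}" for s
          using G'[OF that] has_derivative_continuous by blast
        then show "continuous_on {u..v} (G \<circ> g)"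
          using continuous_on_subset[OF cont sub(1)]
          by (intro continuous_on_compose) (auto intro: continuous_at_imp_continuous_on)
      qed
      then show "(\<lambda>t. \<Phi> (g t) (vector_derivative g (at t))) integrable_on cbox u v"
        by (auto simp: has_integral_integrable)
    qed
  qed
  then show ?thesis by simp
qed

section \<open>Real-octonionic operators\<close>

lemma cJ_linear: "linear (cJ J)"
  by (simp add: linear_iff cJ_def algebra_simps)

lemma cJ_1 [simp]: "cJ J 1 = oone"
  by (simp add: cJ_def)

lemma cJ_mult:
  assumes "J \<in> osphere"
  shows "cJ J (z * w) = omult (cJ J z) (cJ J w)"
  using assms by (simp add: cJ_def osphere_def omult_add omult_scaleR algebra_simps)

lemma opow_cJ: "J \<in> osphere \<Longrightarrow> opow (cJ J z) m = cJ J (z ^ m)"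
  by (induction m) (simp_all add: cJ_mult)

lemma omult_minus_cJ_J: "J \<in> osphere \<Longrightarrow> omult (- cJ J z) J = cJ J (- \<i> * z)"
  using cJ_mult[of J z \<i>] by (simp add: cJ_def[of J \<i>] omult_minus linear_neg[OF cJ_linear] mult.commute)

locale banach_octonion_bimodule = octonion_bimodule L R
  for L :: "oct \<Rightarrow> 'v::banach \<Rightarrow> 'v" and R :: "'v \<Rightarrow> oct \<Rightarrow> 'v" +
  assumes norm_L: "norm (L p x) = norm p * norm x" and norm_R: "norm (R x p) = norm p * norm x"
begin

lemma bounded_linear_L: "bounded_linear (L p)"
  by (rule bounded_linear_intro[where K = "norm p"]) (simp_all add: L_simps norm_L)

lemma bounded_linear_R: "bounded_linear (\<lambda>x. R x p)"
  by (rule bounded_linear_intro[where K = "norm p"]) (simp_all add: R_simps norm_R)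

lemma bounded_linear_ocomp: "bounded_linear (\<lambda>x. ocomp L R x i)"
proof -
  have l: "bounded_linear (\<lambda>x. l i (f x))" if "bounded_linear f" for i and f :: "'v \<Rightarrow> 'v"
    unfolding l_def using bounded_linear_compose[OF bounded_linear_L that] .
  have P: "bounded_linear (\<lambda>x. real_proj (f x))" if "bounded_linear f" for f :: "'v \<Rightarrow> 'v"
    unfolding real_proj_def
    by (intro bounded_linear_const_scaleR bounded_linear_add bounded_linear_sub l that)
  show ?thesis
    unfolding ocomp_eq real_comp_def
    by (cases "i = 0"; cases "i < 8")
      (simp_all add: P bounded_linear_ident bounded_linear_minus l bounded_linear_zero)
qed

definition Rop :: "oct \<Rightarrow> 'v \<Rightarrow>\<^sub>L 'v" where "Rop p = Blinfun (\<lambda>x. R x p)"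

lemma Rop_apply [simp]: "Rop p x = R x p"
  by (simp add: Rop_def bounded_linear_Blinfun_apply bounded_linear_R)

lemma bounded_linear_Rop: "bounded_linear Rop"
proof (rule bounded_linear_intro[where K = 1])
  show "Rop (p + q) = Rop p + Rop q" "Rop (c *\<^sub>R p) = c *\<^sub>R Rop p" for p q c
    by (rule blinfun_eqI, simp add: blinfun.bilinear_simps R_simps')+
  show "norm (Rop p) \<le> norm p * 1" for p
    by (rule norm_blinfun_bound) (simp_all add: norm_R)
qed

definition ext_op :: "('v \<Rightarrow>\<^sub>L 'v) \<Rightarrow> 'v \<Rightarrow>\<^sub>L 'v" where
  "ext_op h = (\<Sum>i<8. Rop (obasis i) o\<^sub>L h o\<^sub>L Blinfun (\<lambda>x. ocomp L R x i))"

lemma ext_op_apply: "ext_op h x = (\<Sum>i<8. R (h (ocomp L R x i)) (obasis i))"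
  by (simp add: ext_op_def blinfun.sum_left bounded_linear_Blinfun_apply bounded_linear_ocomp)

lemma bounded_linear_ext_op: "bounded_linear ext_op"
  unfolding ext_op_def
  by (intro bounded_linear_sum bounded_linear_compose[OF bounded_bilinear.bounded_linear_left[OF bounded_bilinear_blinfun_compose]]
      bounded_bilinear.bounded_linear_right[OF bounded_bilinear_blinfun_compose])

lemma ext_op_R: "v \<in> ReV L R \<Longrightarrow> ext_op h (R v p) = R (h v) p"
proof -
  assume v: "v \<in> ReV L R"
  have "ext_op h (R v p) = (\<Sum>i<8. inner p (obasis i) *\<^sub>R R (h v) (obasis i))"
    by (simp add: ext_op_apply ocomp_R v blinfun.scaleR_right R_simps)
  also have "\<dots> = R (h v) (\<Sum>i<8. inner p (obasis i) *\<^sub>R obasis i)"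
    by (simp add: linear_sum[OF linear_R'] R_simps')
  finally show ?thesis by (simp only: obasis_expand)
qed

lemma ext_op_ReV: "v \<in> ReV L R \<Longrightarrow> ext_op h v = h v"
  using ext_op_R[of v h oone] by simp

lemma ext_op_cong:
  fixes h k :: "'v \<Rightarrow>\<^sub>L 'v"
  assumes "\<And>v. v \<in> ReV L R \<Longrightarrow> h v = k v"
  shows "ext_op h = ext_op k"
  using assms by (intro blinfun_eqI) (simp add: ext_op_apply ocomp_ReV)

lemma eq_ext_op:
  fixes h :: "'v \<Rightarrow>\<^sub>L 'v"
  assumes f: "bounded_linear f" "\<And>v p. v \<in> ReV L R \<Longrightarrow> f (R v p) = R (h v) p"
  shows "Blinfun f = ext_op h"
proof (rule blinfun_eqI)
  fix x
  have "f x = ext_op h x"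
    by (rule oct_decomp_eqI)
      (simp_all add: bounded_linear.linear f ext_op_R bounded_linear.linear[OF blinfun.bounded_linear_right])
  then show "Blinfun f x = ext_op h x" by (simp add: bounded_linear_Blinfun_apply f)
qed

lemma B_RO_R:
  assumes "f \<in> B_RO L R" "v \<in> ReV L R"
  shows "f (R v p) = R (f v) p"
proof (rule eq_if_ReP_eq)
  fix q
  have B: "ReP L R (R (f x) q) = ReP L R (f (R x q))" for x q
  proof -
    have "ReP L R (R (f x) q - f (R x q)) = 0" using assms(1) by (simp add: B_RO_def Bp_def)
    then show ?thesis by (simp add: linear_diff[OF linear_ReP])
  qed
  show "ReP L R (R (f (R v p)) q) = ReP L R (R (R (f v) p) q)"
    by (simp add: B ReV_R_R assms(2) ReP_assoc)
qed

lemma op_rmult_oext: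
  assumes h: "\<And>v. v \<in> ReV L R \<Longrightarrow> h v = A v" and A: "blinfun_apply A' = A"
  shows "Blinfun (op_rmult L R (oext L R (restrict h (ReV L R))) p) = ext_op (Rop p o\<^sub>L A')"
proof (rule eq_ext_op)
  have e: "oext L R (restrict h (ReV L R)) = ext_op A'"
    using h by (auto simp: oext_def ext_op_apply ocomp_ReV A)
  have E: "bounded_linear (blinfun_apply (ext_op A'))" by (rule blinfun.bounded_linear_right)
  show "bounded_linear (op_rmult L R (oext L R (restrict h (ReV L R))) p)"
    unfolding e op_rmult_def[abs_def] Bp_def
    by (intro bounded_linear_sub bounded_linear_compose[OF E] bounded_linear_L
        bounded_linear_compose[OF bounded_linear_R] bounded_linear_R E)
  show "op_rmult L R (oext L R (restrict h (ReV L R))) p (R v q) = R ((Rop p o\<^sub>L A') v) q"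
    if v: "v \<in> ReV L R" for v q
    using associator_alt[of "A v" p q]
    by (simp add: e op_rmult_def Bp_def ext_op_R v ReV_L_R ReV_R_R A)
qed

definition Cop :: "oct \<Rightarrow> complex \<Rightarrow> 'v \<Rightarrow>\<^sub>L 'v" where "Cop J z = Rop (cJ J z)"

lemma Cop_apply [simp]: "Cop J z x = R x (cJ J z)"
  by (simp add: Cop_def)

lemma bounded_linear_Cop: "bounded_linear (Cop J)"
  unfolding Cop_def[abs_def]
  by (intro bounded_linear_compose[OF bounded_linear_Rop] linear_conv_bounded_linear[THEN iffD1] cJ_linear)

lemma integrand_eq:
  assumes J: "J \<in> osphere" and inv: "invertible_op (\<lambda>v. R v (cJ J (g t)) - T v)"
    and A: "blinfun_apply A = inv (\<lambda>v. R v (cJ J (g t)) - T v)"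
  shows "integrand L R T J m g t
    = ext_op (Cop J (- \<i> * vector_derivative g (at t) * g t ^ m) o\<^sub>L A)"
proof -
  have "omult (omult (- cJ J (vector_derivative g (at t))) J) (opow (cJ J (g t)) m)
      = cJ J (- \<i> * vector_derivative g (at t) * g t ^ m)"
    using J by (simp add: omult_minus_cJ_J opow_cJ flip: cJ_mult)
  then show ?thesis
    by (simp add: integrand_def ocirc_inv_def Cop_def Let_def op_rmult_oext[OF _ A])
qed

end

section \<open>The resolvent\<close>

lemma funpow_linear: "bounded_linear T \<Longrightarrow> bounded_linear (T ^^ n)"
  for T :: "'a::real_normed_vector \<Rightarrow> 'a"
  by (induction n) (auto simp: id_def bounded_linear_ident o_def intro: bounded_linear_compose)

lemma funpow_norm_le:
  fixes f :: "'a::real_normed_vector \<Rightarrow> 'a"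
  assumes "\<And>x. norm (f x) \<le> M * norm x" "M \<ge> 0"
  shows "norm ((f ^^ n) x) \<le> M ^ n * norm x"
proof (induction n)
  case (Suc n)
  have "norm ((f ^^ Suc n) x) \<le> M * norm ((f ^^ n) x)" using assms(1) by simp
  also have "\<dots> \<le> M * (M ^ n * norm x)" using Suc assms(2) by (rule mult_left_mono)
  finally show ?case by (simp add: mult_ac)
qed simp

locale octonionic_resolvent = banach_octonion_bimodule L R
  for L :: "oct \<Rightarrow> 'v::banach \<Rightarrow> 'v" and R :: "'v \<Rightarrow> oct \<Rightarrow> 'v" +
  fixes T :: "'v \<Rightarrow> 'v" and J :: oct
  assumes J: "J \<in> osphere" and T: "bounded_linear T"
begin

definition C :: "complex \<Rightarrow> 'v \<Rightarrow> 'v" where "C z x = R x (cJ J z)"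

definition S :: "complex \<Rightarrow> 'v \<Rightarrow> 'v" where "S z x = C z x - T x"

definition res :: "complex \<Rightarrow> 'v \<Rightarrow> 'v" where "res z = inv (S z)"

definition \<rho> :: "complex set" where "\<rho> = {z. cJ J z \<in> rho_star L R T J}"

lemma C_simps: "C z (x + y) = C z x + C z y" "C z (x - y) = C z x - C z y" "C z (- x) = - C z x"
  "C z (c *\<^sub>R x) = c *\<^sub>R C z x" "C z 0 = 0" "C (z + w) x = C z x + C w x" "C (z - w) x = C z x - C w x"
  "C (c *\<^sub>R z) x = c *\<^sub>R C z x" "C w (C z x) = C (z * w) x" "C 1 x = x" "C 0 x = 0"
  by (simp_all add: C_def R_simps R_simps' C_J_assoc[OF J] linear_add[OF cJ_linear]
      linear_diff[OF cJ_linear] linear_cmul[OF cJ_linear] linear_0[OF cJ_linear])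

lemma bounded_linear_C: "bounded_linear (C z)" and bounded_linear_C': "bounded_linear (\<lambda>z. C z x)"
proof -
  show "bounded_linear (C z)" unfolding C_def[abs_def] by (rule bounded_linear_R)
  show "bounded_linear (\<lambda>z. C z x)"
    by (rule linear_conv_bounded_linear[THEN iffD1]) (simp add: linear_iff C_simps)
qed

lemma C_bound: "\<exists>K>0. \<forall>z x. norm (C z x) \<le> K * norm z * norm x"
proof -
  have "bounded_linear (cJ J)" by (simp add: linear_conv_bounded_linear[symmetric] cJ_linear)
  then obtain K where K: "K > 0" "\<And>z. norm (cJ J z) \<le> norm z * K"
    using bounded_linear.pos_bounded by blast
  have "norm (C z x) \<le> K * norm z * norm x" for z x
    using mult_right_mono[OF K(2)[of z], of "norm x"] by (simp add: C_def norm_R mult_ac)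
  with K(1) show ?thesis by blast
qed

lemma bounded_linear_S: "bounded_linear (S z)"
  unfolding S_def[abs_def] by (intro bounded_linear_sub bounded_linear_C T)

lemma S_add: "S (z + w) x = S z x + C w x"
  by (simp add: S_def C_simps)

lemma invertible_S:
  assumes "invertible_op (S z)"
  shows "bounded_linear (res z)" "S z (res z x) = x" "res z (S z x) = x"
proof -
  obtain A where A: "bounded_linear A" "A \<circ> S z = id" "S z \<circ> A = id"
    using assms unfolding invertible_op_def by blast
  then have eq: "res z = A" unfolding res_def by (intro inv_unique_comp)
  have "A (S z x) = x" "S z (A x) = x" using A by (metis comp_apply id_apply)+
  with A(1) show "bounded_linear (res z)" "S z (res z x) = x" "res z (S z x) = x"
    by (simp_all add: eq)
qed

lemma \<rho>_iff: "z \<in> \<rho> \<longleftrightarrow> invertible_op (S z) \<and>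
    (\<forall>n\<ge>1. \<forall>v\<in>ReV L R. \<forall>w. (res z ^^ n) (C w v) = C w ((res z ^^ n) v))"
proof -
  have "(\<lambda>v. R v (cJ J z) - T v) = S z" by (simp add: fun_eq_iff S_def C_def)
  then show ?thesis
    by (auto simp: \<rho>_def rho_star_def CJ_ext_power_assoc_def CJ_def C_def res_def)
qed

lemma \<rho>_invertible: "z \<in> \<rho> \<Longrightarrow> invertible_op (S z)"
  by (simp add: \<rho>_iff)

lemma res_funpow_C: "z \<in> \<rho> \<Longrightarrow> v \<in> ReV L R \<Longrightarrow> (res z ^^ Suc n) (C w v) = C w ((res z ^^ Suc n) v)"
  using \<rho>_iff[of z, THEN iffD1, THEN conjunct2, rule_format, of "Suc n" v w]
  by (simp del: funpow.simps)

lemma res_C: "z \<in> \<rho> \<Longrightarrow> v \<in> ReV L R \<Longrightarrow> res z (C w v) = C w (res z v)"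
  using res_funpow_C[of z v 0] by simp

lemma res_expansion_partial:
  assumes z: "z \<in> \<rho>" and v: "v \<in> ReV L R"
  shows "S (z + d) (\<Sum>k<n. (-1) ^ k *\<^sub>R (res z ^^ Suc k) (C (d ^ k * w) v))
    = C w v - (-1) ^ n *\<^sub>R (res z ^^ n) (C (d ^ n * w) v)"
proof (induction n)
  case 0
  then show ?case using bounded_linear.linear[OF bounded_linear_S] by (simp add: linear_0)
next
  case (Suc n)
  note S = linear_add[OF bounded_linear.linear[OF bounded_linear_S]]
    linear_cmul[OF bounded_linear.linear[OF bounded_linear_S]]
  have "C d ((res z ^^ Suc n) (C (d ^ n * w) v)) = (res z ^^ Suc n) (C (d ^ Suc n * w) v)"
    by (simp only: res_funpow_C[OF z v] C_simps) (simp add: mult_ac)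
  moreover have "S z ((res z ^^ Suc n) x) = (res z ^^ n) x" for x
    using invertible_S(2)[OF \<rho>_invertible[OF z]] by simp
  ultimately have "S (z + d) ((res z ^^ Suc n) (C (d ^ n * w) v))
      = (res z ^^ n) (C (d ^ n * w) v) + (res z ^^ Suc n) (C (d ^ Suc n * w) v)"
    by (simp only: S_add[of z d])
  then have "S (z + d) (\<Sum>k<Suc n. (-1) ^ k *\<^sub>R (res z ^^ Suc k) (C (d ^ k * w) v))
      = C w v - (-1) ^ n *\<^sub>R (res z ^^ n) (C (d ^ n * w) v) + (-1) ^ n *\<^sub>R
        ((res z ^^ n) (C (d ^ n * w) v) + (res z ^^ Suc n) (C (d ^ Suc n * w) v))"
    by (simp only: sum.lessThan_Suc S Suc.IH)
  then show ?case by (simp only: scaleR_add_right power_Suc) (simp del: funpow.simps power_Suc)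
qed

text \<open>Away from z the shifted operator is only shown to be injective; this already determines the value of
  its inv at the sum of the series.\<close>
lemma res_expansion:
  assumes z: "z \<in> \<rho>"
  shows "\<exists>r M. r > 0 \<and> M > 0 \<and> M * r < 1 \<and> (\<forall>x. norm (res z x) \<le> M * norm x) \<and>
    (\<forall>d v w. norm d < r \<longrightarrow> v \<in> ReV L R \<longrightarrow>
      (\<lambda>k. (-1) ^ k *\<^sub>R (res z ^^ Suc k) (C (d ^ k * w) v)) sums res (z + d) (C w v))"
proof -
  note inv = invertible_S[OF \<rho>_invertible[OF z]]
  obtain K where K: "K > 0" "\<And>z x. norm (C z x) \<le> K * norm z * norm x" using C_bound by blast
  obtain M where M: "M > 0" "\<And>x. norm (res z x) \<le> M * norm x"
    using bounded_linear.pos_bounded[OF inv(1)] by (metis mult.commute)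
  define r where "r = 1 / (2 * M * (K + 1))"
  have r: "r > 0" "M * r < 1" "M * K * r < 1"
  proof -
    show "r > 0" using M(1) K(1) by (simp add: r_def)
    have "M * r = 1 / (2 * (K + 1))" "M * K * r = K / (2 * (K + 1))"
      using M(1) by (simp_all add: r_def)
    moreover have "1 / (2 * (K + 1)) < 1" "K / (2 * (K + 1)) < 1"
      using K(1) by (simp_all add: divide_less_eq)
    ultimately show "M * r < 1" "M * K * r < 1" by simp_all
  qed
  have sums: "(\<lambda>k. (-1) ^ k *\<^sub>R (res z ^^ Suc k) (C (d ^ k * w) v)) sums res (z + d) (C w v)"
    if d: "norm d < r" and v: "v \<in> ReV L R" for d v w
  proof -
    have "inj (S (z + d))"
      unfolding linear_injective_0[OF bounded_linear.linear[OF bounded_linear_S]]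
    proof (intro allI impI)
      fix x assume "S (z + d) x = 0"
      then have "x = res z (- C d x)"
        using inv(3)[of x] by (simp add: S_add add_eq_0_iff2)
      then have "norm x \<le> M * norm (C d x)" by (metis M(2) norm_minus_cancel)
      also have "\<dots> \<le> M * (K * norm d * norm x)"
        using M(1) K(2)[of d x] by (intro mult_left_mono) auto
      also have "\<dots> = (M * K * norm d) * norm x" by simp
      finally have le: "norm x \<le> (M * K * norm d) * norm x" .
      have "M * K * norm d \<le> M * K * r" using M(1) K(1) d by (intro mult_left_mono) auto
      then have "M * K * norm d < 1" using r(3) by linarith
      show "x = 0"
      proof (rule ccontr)
        assume "x \<noteq> 0"
        then have "(M * K * norm d) * norm x < 1 * norm x"
          using \<open>M * K * norm d < 1\<close> by (intro mult_strict_right_mono) auto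
        with le show False by simp
      qed
    qed
    define c where "c k w = (-1) ^ k *\<^sub>R (res z ^^ Suc k) (C w v)" for k :: nat and w
    have "norm (c k w) \<le> (M * K * norm v) * M ^ k * norm w" for k w
    proof -
      have "norm (c k w) = norm ((res z ^^ Suc k) (C w v))" by (simp add: c_def power_abs)
      also have "\<dots> \<le> M ^ Suc k * norm (C w v)"
        using M by (intro funpow_norm_le) auto
      also have "\<dots> \<le> M ^ Suc k * (K * norm w * norm v)"
        using K(2) M(1) by (intro mult_left_mono) auto
      finally show ?thesis by (simp add: mult_ac)
    qed
    from power_series_summable(1)[OF this M(1) _ r(2) d, of w]
    have sum: "summable (\<lambda>k. c k (d ^ k * w))" using M(1) K(1) by simp
    define y where "y = (\<Sum>k. c k (d ^ k * w))"
    have y: "(\<lambda>n. \<Sum>k<n. c k (d ^ k * w)) \<longlonglongrightarrow> y"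
      using sum unfolding y_def by (rule summable_LIMSEQ)
    have "(\<lambda>n. S z (c n (d ^ n * w))) \<longlonglongrightarrow> S z 0"
      using bounded_linear.tendsto[OF bounded_linear_S summable_LIMSEQ_zero[OF sum]] .
    moreover have "S z (c n (d ^ n * w)) = (-1) ^ n *\<^sub>R (res z ^^ n) (C (d ^ n * w) v)" for n
      using inv(2) linear_cmul[OF bounded_linear.linear[OF bounded_linear_S]] by (simp add: c_def)
    ultimately have "(\<lambda>n. C w v - (-1) ^ n *\<^sub>R (res z ^^ n) (C (d ^ n * w) v)) \<longlonglongrightarrow> C w v - S z 0"
      by (intro tendsto_diff tendsto_const) simp
    then have "(\<lambda>n. S (z + d) (\<Sum>k<n. c k (d ^ k * w))) \<longlonglongrightarrow> C w v"
      using res_expansion_partial[OF z v, of d w] linear_0[OF bounded_linear.linear[OF bounded_linear_S]]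
      by (simp add: c_def)
    moreover have "(\<lambda>n. S (z + d) (\<Sum>k<n. c k (d ^ k * w))) \<longlonglongrightarrow> S (z + d) y"
      by (rule bounded_linear.tendsto[OF bounded_linear_S y])
    ultimately have "S (z + d) y = C w v" using LIMSEQ_unique by blast
    then have "res (z + d) (C w v) = y"
      using \<open>inj (S (z + d))\<close> unfolding res_def by (metis inv_f_f)
    then show ?thesis using y by (simp add: sums_def c_def)
  qed
  show ?thesis using r(1) M(1) r(2) M(2) sums by blast
qed

lemma \<rho>_limit:
  assumes s: "invertible_op (S s)" and lim: "\<And>e. e > 0 \<Longrightarrow> \<exists>z\<in>\<rho>. dist z s < e"
  shows "s \<in> \<rho>"
proof -
  note inv = invertible_S[OF s]
  obtain K where K: "K > 0" "\<And>z x. norm (C z x) \<le> K * norm z * norm x" using C_bound by blast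
  obtain M where M: "M > 0" "\<And>x. norm (res s x) \<le> M * norm x"
    using bounded_linear.pos_bounded[OF inv(1)] by (metis mult.commute)
  define e where "e n = 1 / (2 * M * K) * inverse (real (Suc n))" for n
  have e: "e n > 0" for n using M(1) K(1) by (simp add: e_def)
  have e0: "e \<longlonglongrightarrow> 0"
    unfolding e_def[abs_def] by (rule tendsto_mult_right_zero[OF LIMSEQ_inverse_real_of_nat])
  have "\<forall>n. \<exists>z. z \<in> \<rho> \<and> dist z s < e n" using lim e by blast
  from choice[OF this] obtain z where "\<forall>n. z n \<in> \<rho> \<and> dist (z n) s < e n" by blast
  then have z: "z n \<in> \<rho>" "dist (z n) s < e n" for n by simp_all
  define d where "d n = z n - s" for n
  have d: "norm (d n) < e n" for n using z(2)[of n] by (simp add: d_def dist_norm)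
  note zinv = invertible_S[OF \<rho>_invertible[OF z(1)]]
  have Sz: "S (z n) x = S s x + C (d n) x" for n x
    using S_add[of s "d n" x] by (simp add: d_def)
  have small: "M * K * norm (d n) \<le> 1 / 2" for n
  proof -
    have "M * K * norm (d n) \<le> M * K * e n" using M(1) K(1) d[of n] by (intro mult_left_mono) auto
    also have "\<dots> = inverse (real (Suc n)) / 2" using M(1) K(1) by (simp add: e_def)
    also have "\<dots> \<le> 1 / 2" by (simp add: inverse_le_1_iff)
    finally show ?thesis .
  qed
  have zbound: "norm (res (z n) x) \<le> 2 * M * norm x" for n x
  proof -
    define y where "y = res (z n) x"
    have "S s y = x - C (d n) y" using zinv(2)[of n x] Sz[of n y] by (simp add: y_def algebra_simps)
    then have "norm y \<le> M * norm (x - C (d n) y)" using inv(3)[of y] M(2)[of "S s y"] by simp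
    also have "\<dots> \<le> M * (norm x + K * norm (d n) * norm y)"
      using M(1) norm_triangle_ineq4[of x "C (d n) y"] K(2)[of "d n" y] by (intro mult_left_mono) auto
    also have "\<dots> = M * norm x + (M * K * norm (d n)) * norm y" by (simp add: algebra_simps)
    also have "\<dots> \<le> M * norm x + 1 / 2 * norm y" using small by (intro add_left_mono mult_right_mono) auto
    finally show ?thesis by (simp add: y_def)
  qed
  have diff: "norm (res (z n) x - res s x) \<le> 2 * M * (K * norm (d n) * (M * norm x))" for n x
  proof -
    have "S (z n) (res s x) = x + C (d n) (res s x)" using inv(2) Sz by simp
    then have "res s x = res (z n) (x + C (d n) (res s x))" by (metis zinv(3))
    then have "res (z n) x - res s x = - res (z n) (C (d n) (res s x))"
      using linear_add[OF bounded_linear.linear[OF zinv(1)]] by (simp add: algebra_simps)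
    then have "norm (res (z n) x - res s x) \<le> 2 * M * norm (C (d n) (res s x))" using zbound by simp
    also have "\<dots> \<le> 2 * M * (K * norm (d n) * norm (res s x))"
      using M(1) K(2)[of "d n" "res s x"] by (intro mult_left_mono) auto
    also have "\<dots> \<le> 2 * M * (K * norm (d n) * (M * norm x))"
      using M K(1) by (intro mult_left_mono) auto
    finally show ?thesis .
  qed
  have d0: "(\<lambda>n. norm (d n)) \<longlonglongrightarrow> 0"
    by (rule Lim_null_comparison[OF always_eventually e0]) (simp add: d less_imp_le)
  have conv: "(\<lambda>j. (res (z j) ^^ n) x) \<longlonglongrightarrow> (res s ^^ n) x" for n x
  proof (induction n)
    case (Suc n)
    define y where "y = (res s ^^ n) x"
    define u where "u j = (res (z j) ^^ n) x" for j
    have "(\<lambda>j. u j - y) \<longlonglongrightarrow> 0" unfolding u_def y_def by (rule LIM_zero[OF Suc])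
    from tendsto_add[OF tendsto_mult_right_zero[OF tendsto_norm_zero[OF this], of "2 * M"]
        tendsto_mult_right_zero[OF tendsto_mult_left_zero[OF tendsto_mult_right_zero[OF d0]]]]
    have lim0: "(\<lambda>j. 2 * M * norm (u j - y) + 2 * M * (K * norm (d j) * (M * norm y))) \<longlonglongrightarrow> 0"
      by (simp only: add_0)
    have le: "norm (res (z j) (u j) - res s y)
        \<le> 2 * M * norm (u j - y) + 2 * M * (K * norm (d j) * (M * norm y))" for j
    proof -
      have "res (z j) (u j) - res s y = res (z j) (u j - y) + (res (z j) y - res s y)"
        using linear_diff[OF bounded_linear.linear[OF zinv(1)]] by simp
      then have "norm (res (z j) (u j) - res s y) \<le> norm (res (z j) (u j - y)) + norm (res (z j) y - res s y)"
        by (metis norm_triangle_ineq)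
      then show ?thesis using zbound[of j "u j - y"] diff[of j y] by linarith
    qed
    have "(\<lambda>j. res (z j) (u j) - res s y) \<longlonglongrightarrow> 0"
      using le by (intro Lim_null_comparison[OF _ lim0] always_eventually allI)
    then have "(\<lambda>j. res (z j) (u j)) \<longlonglongrightarrow> res s y" by (rule LIM_zero_cancel)
    then show ?case by (simp add: u_def y_def)
  qed simp
  have "(res s ^^ n) (C w v) = C w ((res s ^^ n) v)" if n: "n \<ge> 1" and v: "v \<in> ReV L R" for n v w
  proof -
    obtain k where k: "n = Suc k" using n by (cases n) auto
    have "(\<lambda>j. (res (z j) ^^ n) (C w v)) \<longlonglongrightarrow> C w ((res s ^^ n) v)"
      using bounded_linear.tendsto[OF bounded_linear_C conv[of n v]] res_funpow_C[OF z(1) v]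
      unfolding k by simp
    then show ?thesis using conv LIMSEQ_unique by blast
  qed
  then show ?thesis using s by (simp add: \<rho>_iff)
qed

lemma res_C_power:
  assumes z: "z \<in> \<rho>" and v: "v \<in> ReV L R"
  shows "C (u * z ^ m) (res z v) = (T ^^ m) (res z (C u v)) + (\<Sum>j<m. (T ^^ (m - 1 - j)) (C (u * z ^ j) v))"
proof (induction m)
  case 0
  then show ?case by (simp add: res_C[OF z v])
next
  case (Suc m)
  have step: "C z (res z x) = x + T (res z x)" for x
    using invertible_S(2)[OF \<rho>_invertible[OF z], of x] by (simp add: S_def algebra_simps)
  have "C (u * z ^ Suc m) (res z v) = C z (C (u * z ^ m) (res z v))"
    by (simp add: C_simps mult_ac)
  also have "\<dots> = C (u * z ^ m) v + T (C (u * z ^ m) (res z v))"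
    by (simp add: res_C[OF z v, symmetric] step)
  also have "\<dots> = (T ^^ Suc m) (res z (C u v)) + ((\<Sum>j<m. T ((T ^^ (m - 1 - j)) (C (u * z ^ j) v)))
      + C (u * z ^ m) v)"
    unfolding Suc.IH
    by (simp add: linear_add[OF bounded_linear.linear[OF T]] linear_sum[OF bounded_linear.linear[OF T]])
  also have "(\<Sum>j<m. T ((T ^^ (m - 1 - j)) (C (u * z ^ j) v))) = (\<Sum>j<m. (T ^^ (m - j)) (C (u * z ^ j) v))"
  proof (rule sum.cong)
    fix j assume "j \<in> {..<m}"
    then have "m - j = Suc (m - 1 - j)" by auto
    then show "T ((T ^^ (m - 1 - j)) (C (u * z ^ j) v)) = (T ^^ (m - j)) (C (u * z ^ j) v)" by simp
  qed simp
  finally show ?case by simp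
qed

end

context octonionic_resolvent
begin

lemma res_analytic:
  fixes \<phi> :: "'v \<Rightarrow> complex"
  assumes \<phi>: "bounded_linear \<phi>" "\<And>z x. \<phi> (C z x) = z * \<phi> x" and v: "v \<in> ReV L R"
  shows "(\<lambda>z. \<phi> (res z v)) analytic_on \<rho>"
  unfolding analytic_on_def
proof
  fix z assume z: "z \<in> \<rho>"
  obtain r M where "r > 0" and sums: "\<And>d v w. norm d < r \<Longrightarrow> v \<in> ReV L R \<Longrightarrow>
      (\<lambda>k. (-1) ^ k *\<^sub>R (res z ^^ Suc k) (C (d ^ k * w) v)) sums res (z + d) (C w v)"
    using res_expansion[OF z] by blast
  have "(\<lambda>z. \<phi> (res z v)) holomorphic_on ball z r"
  proof (rule power_series_holomorphic)
    fix w assume "w \<in> ball z r"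
    then have d: "norm (w - z) < r" by (simp add: dist_norm norm_minus_commute)
    have "\<phi> ((-1) ^ k *\<^sub>R (res z ^^ Suc k) (C ((w - z) ^ k * 1) v))
        = (-1) ^ k * \<phi> ((res z ^^ Suc k) v) * (w - z) ^ k" for k
      using linear_cmul[OF bounded_linear.linear[OF \<phi>(1)], of "(-1) ^ k"]
      by (simp only: res_funpow_C[OF z v] \<phi>(2)) (simp add: scaleR_conv_of_real del: funpow.simps)
    then show "(\<lambda>k. (-1) ^ k * \<phi> ((res z ^^ Suc k) v) * (w - z) ^ k) sums \<phi> (res w v)"
      using bounded_linear.sums[OF \<phi>(1) sums[OF d v, of 1]] by (simp add: C_simps del: funpow.simps)
  qed
  then show "\<exists>e>0. (\<lambda>z. \<phi> (res z v)) holomorphic_on ball z e" using \<open>r > 0\<close> by blast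
qed

lemma bounded_linear_Cop_ii: "bounded_linear (\<lambda>w. Cop J (- \<i> * w))"
  by (rule bounded_linear_compose[OF bounded_linear_Cop bounded_linear_mult_right])

lemma Cop_C: "Cop J z x = C z x"
  by (simp add: C_def)

lemma Blinfun_res: "z \<in> \<rho> \<Longrightarrow> blinfun_apply (Blinfun (res z)) = res z"
  using invertible_S(1)[OF \<rho>_invertible] by (simp add: bounded_linear_Blinfun_apply)

lemma res_local_primitive:
  assumes z0: "z0 \<in> \<rho>"
  shows "\<exists>r>0. \<exists>G. \<forall>z\<in>ball z0 r \<inter> \<rho>.
    (G has_derivative (\<lambda>w. ext_op (Cop J (- \<i> * w) o\<^sub>L Blinfun (res z)))) (at z)"
proof -
  obtain r M where r: "r > 0" "M > 0" "M * r < 1" "\<And>x. norm (res z0 x) \<le> M * norm x"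
    and sums: "\<And>d v w. norm d < r \<Longrightarrow> v \<in> ReV L R \<Longrightarrow>
      (\<lambda>k. (-1) ^ k *\<^sub>R (res z0 ^^ Suc k) (C (d ^ k * w) v)) sums res (z0 + d) (C w v)"
    using res_expansion[OF z0] by blast
  define B where "B k = Blinfun (res z0 ^^ Suc k)" for k
  have B: "blinfun_apply (B k) = res z0 ^^ Suc k" for k
    unfolding B_def
    by (intro bounded_linear_Blinfun_apply funpow_linear invertible_S(1)[OF \<rho>_invertible[OF z0]])
  define c where "c k w = ext_op ((-1) ^ k *\<^sub>R (B k o\<^sub>L Cop J (- \<i> * w)))" for k :: nat and w
  have lin: "bounded_linear (c k)" for k
    unfolding c_def[abs_def]
    by (intro bounded_linear_compose[OF bounded_linear_ext_op] bounded_linear_const_scaleR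
        bounded_linear_compose[OF bounded_bilinear.bounded_linear_right[OF bounded_bilinear_blinfun_compose]
          bounded_linear_Cop_ii])
  obtain Ke where Ke: "Ke > 0" "\<And>h. norm (ext_op h) \<le> norm h * Ke"
    using bounded_linear.pos_bounded[OF bounded_linear_ext_op] by blast
  obtain Kc where Kc: "Kc > 0" "\<And>w. norm (Cop J (- \<i> * w)) \<le> norm w * Kc"
    using bounded_linear.pos_bounded[OF bounded_linear_Cop_ii] by blast
  have bound: "norm (c k w) \<le> (Ke * M * Kc) * M ^ k * norm w" for k w
  proof -
    have "norm (B k) \<le> M ^ Suc k"
      using funpow_norm_le[OF r(4), of "Suc k"] r(2) by (intro norm_blinfun_bound) (simp_all only: B zero_le_power less_imp_le)
    then have "norm (B k) * norm (Cop J (- \<i> * w)) \<le> M ^ Suc k * (norm w * Kc)"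
      using Kc(2)[of w] r(2) by (intro mult_mono) auto
    then have "norm (B k o\<^sub>L Cop J (- \<i> * w)) \<le> M ^ Suc k * (norm w * Kc)"
      using norm_blinfun_compose[of "B k" "Cop J (- \<i> * w)"] by linarith
    then have "norm ((-1) ^ k *\<^sub>R (B k o\<^sub>L Cop J (- \<i> * w))) * Ke \<le> M ^ Suc k * (norm w * Kc) * Ke"
      using Ke(1) by (intro mult_right_mono) (simp_all add: power_abs)
    then show ?thesis
      using Ke(2)[of "(-1) ^ k *\<^sub>R (B k o\<^sub>L Cop J (- \<i> * w))"] by (simp add: c_def mult_ac)
  qed
  have K0: "Ke * M * Kc \<ge> 0" using Ke(1) Kc(1) r(2) by simp
  obtain G where G: "\<And>z. z \<in> ball z0 r \<Longrightarrow>
      (G has_derivative (\<lambda>w. \<Sum>k. c k ((z - z0) ^ k * w))) (at z)"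
    using power_series_primitive[OF lin bound r(2) K0 r(3,1), of z0] by blast
  have sum_eq: "(\<Sum>k. c k ((z - z0) ^ k * w)) = ext_op (Cop J (- \<i> * w) o\<^sub>L Blinfun (res z))"
    if z: "z \<in> ball z0 r" "z \<in> \<rho>" for z w
  proof -
    have d: "norm (z - z0) < r" using z(1) by (simp add: dist_norm norm_minus_commute)
    note sum = power_series_summable(1)[OF bound r(2) K0 r(3) d, of w]
    define X where "X = (\<Sum>k. c k ((z - z0) ^ k * w))"
    have "Blinfun (blinfun_apply X) = ext_op (Cop J (- \<i> * w) o\<^sub>L Blinfun (res z))"
    proof (rule eq_ext_op[OF blinfun.bounded_linear_right])
      fix v p assume v: "v \<in> ReV L R"
      have "(\<lambda>k. c k ((z - z0) ^ k * w) (R v p)) sums X (R v p)"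
        unfolding X_def by (rule bounded_linear.sums[OF blinfun.bounded_linear_left summable_sums[OF sum]])
      moreover have "c k ((z - z0) ^ k * w) (R v p)
          = R ((-1) ^ k *\<^sub>R (res z0 ^^ Suc k) (C ((z - z0) ^ k * (- \<i> * w)) v)) p" for k
        by (simp add: c_def ext_op_R[OF v] blinfun.scaleR_left B Cop_C mult_ac del: funpow.simps Cop_apply)
      moreover have "(\<lambda>k. R ((-1) ^ k *\<^sub>R (res z0 ^^ Suc k) (C ((z - z0) ^ k * (- \<i> * w)) v)) p)
          sums R (res (z0 + (z - z0)) (C (- \<i> * w) v)) p"
        by (rule bounded_linear.sums[OF bounded_linear_R sums[OF d v]])
      ultimately have "X (R v p) = R (res z (C (- \<i> * w) v)) p"
        using sums_unique2 by fastforce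
      then show "X (R v p) = R ((Cop J (- \<i> * w) o\<^sub>L Blinfun (res z)) v) p"
        by (simp only: blinfun_apply_blinfun_compose Blinfun_res[OF z(2)] Cop_C res_C[OF z(2) v])
    qed
    then show ?thesis by (simp add: X_def blinfun_apply_inverse)
  qed
  have "(G has_derivative (\<lambda>w. ext_op (Cop J (- \<i> * w) o\<^sub>L Blinfun (res z)))) (at z)"
    if "z \<in> ball z0 r" "z \<in> \<rho>" for z
    using G[OF that(1)] unfolding sum_eq[OF that] .
  then show ?thesis using r(1) by blast
qed

lemma integrand_res:
  assumes "g t \<in> \<rho>"
  shows "integrand L R T J m g t
    = ext_op (Cop J (- \<i> * vector_derivative g (at t) * g t ^ m) o\<^sub>L Blinfun (res (g t)))"
proof -
  have S: "(\<lambda>v. R v (cJ J (g t)) - T v) = S (g t)" by (simp add: fun_eq_iff S_def C_def)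
  show ?thesis
    by (rule integrand_eq[OF J]) (simp_all add: S \<rho>_invertible[OF assms] Blinfun_res[OF assms] res_def[symmetric])
qed

lemma Blinfun_T: "blinfun_apply (Blinfun (T ^^ n)) = T ^^ n"
  by (intro bounded_linear_Blinfun_apply funpow_linear T)

lemma integrand_split:
  assumes z: "g t \<in> \<rho>"
  defines "g' \<equiv> vector_derivative g (at t)"
  shows "integrand L R T J m g t
    = ext_op (Blinfun (T ^^ m) o\<^sub>L ext_op (Cop J (- \<i> * g') o\<^sub>L Blinfun (res (g t))))
      + (\<Sum>j<m. ext_op (Blinfun (T ^^ (m - 1 - j)) o\<^sub>L Cop J (- \<i> * (g t ^ j * g'))))"
proof -
  note E = linear_add[OF bounded_linear.linear[OF bounded_linear_ext_op]]
    linear_sum[OF bounded_linear.linear[OF bounded_linear_ext_op]]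
  have "ext_op (Cop J (- \<i> * g' * g t ^ m) o\<^sub>L Blinfun (res (g t)))
    = ext_op ((Blinfun (T ^^ m) o\<^sub>L ext_op (Cop J (- \<i> * g') o\<^sub>L Blinfun (res (g t))))
      + (\<Sum>j<m. Blinfun (T ^^ (m - 1 - j)) o\<^sub>L Cop J (- \<i> * (g t ^ j * g'))))"
  proof (rule ext_op_cong)
    fix v assume v: "v \<in> ReV L R"
    have "(Cop J (- \<i> * g' * g t ^ m) o\<^sub>L Blinfun (res (g t))) v = C (- \<i> * g' * g t ^ m) (res (g t) v)"
      by (simp add: Blinfun_res[OF z] Cop_C del: Cop_apply)
    also have "\<dots> = (T ^^ m) (res (g t) (C (- \<i> * g') v))
        + (\<Sum>j<m. (T ^^ (m - 1 - j)) (C (- \<i> * g' * g t ^ j) v))"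
      by (rule res_C_power[OF z v])
    also have "\<dots> = ((Blinfun (T ^^ m) o\<^sub>L ext_op (Cop J (- \<i> * g') o\<^sub>L Blinfun (res (g t))))
      + (\<Sum>j<m. Blinfun (T ^^ (m - 1 - j)) o\<^sub>L Cop J (- \<i> * (g t ^ j * g')))) v"
      by (simp add: blinfun.add_left blinfun.sum_left Blinfun_T ext_op_ReV[OF v] Blinfun_res[OF z]
          Cop_C res_C[OF z v] mult_ac del: Cop_apply)
    finally show "(Cop J (- \<i> * g' * g t ^ m) o\<^sub>L Blinfun (res (g t))) v
      = ((Blinfun (T ^^ m) o\<^sub>L ext_op (Cop J (- \<i> * g') o\<^sub>L Blinfun (res (g t))))
      + (\<Sum>j<m. Blinfun (T ^^ (m - 1 - j)) o\<^sub>L Cop J (- \<i> * (g t ^ j * g')))) v" .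
  qed
  then show ?thesis unfolding integrand_res[of g t m, OF z] g'_def[symmetric] by (simp only: E)
qed

lemma integrand_integrable:
  assumes g: "valid_path g" and im: "path_image g \<subseteq> \<rho>"
  shows "integrand L R T J m g integrable_on {0..1}"
proof -
  define g' where "g' t = vector_derivative g (at t)" for t
  have in_\<rho>: "g t \<in> \<rho>" if "t \<in> {0..1}" for t using im that by (auto simp: path_image_def)
  have lin: "bounded_linear (\<lambda>X. ext_op (Blinfun (T ^^ n) o\<^sub>L X))" for n
    by (rule bounded_linear_compose[OF bounded_linear_ext_op
          bounded_bilinear.bounded_linear_right[OF bounded_bilinear_blinfun_compose]])
  have "(\<lambda>t. ext_op (Cop J (- \<i> * g' t) o\<^sub>L Blinfun (res (g t)))) integrable_on {0..1}"
    unfolding g'_def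
  proof (rule integrable_on_path_if_local_primitive[OF g, where
        \<Phi> = "\<lambda>z w. ext_op (Cop J (- \<i> * w) o\<^sub>L Blinfun (res z))"])
    fix z assume "z \<in> path_image g"
    then show "\<exists>r>0. \<exists>G. \<forall>w\<in>ball z r \<inter> path_image g.
        (G has_derivative (\<lambda>u. ext_op (Cop J (- \<i> * u) o\<^sub>L Blinfun (res w)))) (at w)"
      using res_local_primitive[of z] im by blast
  qed
  from integrable_linear[OF this lin]
  have 1: "(\<lambda>t. ext_op (Blinfun (T ^^ m) o\<^sub>L ext_op (Cop J (- \<i> * g' t) o\<^sub>L Blinfun (res (g t)))))
      integrable_on {0..1}" by (simp add: o_def)
  have 2: "(\<lambda>t. ext_op (Blinfun (T ^^ (m - 1 - j)) o\<^sub>L Cop J (- \<i> * (g t ^ j * g' t)))) integrable_on {0..1}"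
    for j
  proof -
    have "(\<lambda>z. z ^ j) contour_integrable_on g"
      by (rule contour_integrable_holomorphic_simple[OF _ open_UNIV g]) (auto intro!: holomorphic_intros)
    then have "(\<lambda>t. g t ^ j * g' t) integrable_on {0..1}"
      unfolding contour_integrable_on g'_def .
    from integrable_linear[OF this bounded_linear_compose[OF lin bounded_linear_Cop_ii]]
    show ?thesis by (simp add: o_def)
  qed
  have "(\<lambda>t. ext_op (Blinfun (T ^^ m) o\<^sub>L ext_op (Cop J (- \<i> * g' t) o\<^sub>L Blinfun (res (g t))))
      + (\<Sum>j<m. ext_op (Blinfun (T ^^ (m - 1 - j)) o\<^sub>L Cop J (- \<i> * (g t ^ j * g' t))))) integrable_on {0..1}"
    by (intro integrable_add 1 integrable_sum 2 finite_lessThan)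
  then show ?thesis
    by (rule integrable_eq) (simp add: integrand_split[OF in_\<rho>] g'_def)
qed

lemma ex_C_functional:
  assumes "x \<noteq> 0"
  shows "\<exists>\<phi>::'v \<Rightarrow> complex. bounded_linear \<phi> \<and> (\<forall>z x. \<phi> (C z x) = z * \<phi> x) \<and> \<phi> x \<noteq> 0"
proof -
  obtain f :: "'v \<Rightarrow> real" where f: "bounded_linear f" "f x \<noteq> 0"
    using ex_bounded_linear_functional[OF assms] by blast
  define \<phi> where "\<phi> y = complex_of_real (f y) - \<i> * complex_of_real (f (C \<i> y))" for y
  note fl = linear_add[OF bounded_linear.linear[OF f(1)]] linear_cmul[OF bounded_linear.linear[OF f(1)]]
    linear_neg[OF bounded_linear.linear[OF f(1)]]
  have \<phi>: "bounded_linear \<phi>"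
    unfolding \<phi>_def[abs_def]
    by (intro bounded_linear_sub bounded_linear_compose[OF bounded_linear_of_real] f(1)
        bounded_linear_compose[OF bounded_linear_mult_right] bounded_linear_compose[OF f(1) bounded_linear_C])
  have "C (-1) y = - y" for y using C_simps(8)[of "-1" 1 y] C_simps(10)[of y] by simp
  then have i: "\<phi> (C \<i> y) = \<i> * \<phi> y" for y
    by (simp add: \<phi>_def C_simps fl algebra_simps)
  have "\<phi> (C z y) = z * \<phi> y" for z y
  proof -
    have "Re z *\<^sub>R 1 + Im z *\<^sub>R \<i> = z" by (simp add: complex_eq_iff)
    then have "C z y = C (Re z *\<^sub>R 1 + Im z *\<^sub>R \<i>) y" by simp
    also have "\<dots> = Re z *\<^sub>R y + Im z *\<^sub>R C \<i> y" by (simp only: C_simps)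
    finally have "\<phi> (C z y) = Re z *\<^sub>R \<phi> y + Im z *\<^sub>R (\<i> * \<phi> y)"
      by (simp add: linear_add[OF bounded_linear.linear[OF \<phi>]] linear_cmul[OF bounded_linear.linear[OF \<phi>]] i)
    also have "\<dots> = z * \<phi> y"
      by (simp add: complex_eq_iff algebra_simps)
    finally show ?thesis .
  qed
  moreover have "Re (\<phi> x) = f x" by (simp add: \<phi>_def)
  then have "\<phi> x \<noteq> 0" using f(2) by auto
  ultimately show ?thesis using \<phi> by blast
qed

end

section \<open>The integral formula\<close>

lemma CJ_subset:
  assumes "cJ J z \<in> CJ I" "Im z \<noteq> 0"
  shows "CJ J \<subseteq> CJ I"
proof -
  obtain w where w: "cJ J z = cJ I w" using assms(1) by (auto simp: CJ_def)
  have c: "cJ K u = Re u *\<^sub>R oone + Im u *\<^sub>R K" for K u by (simp add: cJ_def)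
  define a where "a = (Re w - Re z) / Im z"
  define b where "b = Im w / Im z"
  have "Im z *\<^sub>R J = (Re w - Re z) *\<^sub>R oone + Im w *\<^sub>R I"
    using w by (simp add: c algebra_simps)
  then have "Im z *\<^sub>R J = Im z *\<^sub>R (a *\<^sub>R oone + b *\<^sub>R I)"
    using assms(2) by (simp add: a_def b_def scaleR_add_right)
  then have J: "J = a *\<^sub>R oone + b *\<^sub>R I" using assms(2) by simp
  have "cJ J u = cJ I (Complex (Re u + Im u * a) (Im u * b))" for u
    by (simp add: c J algebra_simps)
  then show ?thesis by (auto simp: CJ_def)
qed

lemma winding_number_zero_large:
  assumes "\<And>g. g \<in> set gs \<Longrightarrow> path g \<and> pathfinish g = pathstart g"
  shows "\<exists>B. \<forall>g\<in>set gs. \<forall>z. B \<le> norm z \<longrightarrow> winding_number g z = 0"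
proof -
  have "\<forall>g\<in>set gs. \<forall>\<^sub>F z in at_infinity. winding_number g z = 0"
  proof
    fix g assume "g \<in> set gs"
    then show "\<forall>\<^sub>F z in at_infinity. winding_number g z = 0"
      unfolding eventually_at_infinity
      using assms winding_number_zero_at_infinity[of g] by blast
  qed
  then have "\<forall>\<^sub>F z in at_infinity. \<forall>g\<in>set gs. winding_number g z = 0"
    by (simp add: eventually_ball_finite)
  then show ?thesis unfolding eventually_at_infinity by blast
qed

lemma pos_boundary_param_bounded:
  assumes "pos_boundary_param D gs"
  shows "bounded D"
proof -
  have "path g \<and> pathfinish g = pathstart g" if "g \<in> set gs" for g
    using assms that by (simp add: pos_boundary_param_def valid_path_imp_path)
  then obtain B where B: "\<And>g z. g \<in> set gs \<Longrightarrow> B \<le> norm z \<Longrightarrow> winding_number g z = 0"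
    using winding_number_zero_large[of gs] by blast
  have "norm z \<le> B" if "z \<in> D" for z
  proof (rule ccontr)
    assume "\<not> norm z \<le> B"
    then have "map (\<lambda>g. winding_number g z) gs = map (\<lambda>g. 0) gs" using B by simp
    then have "(\<Sum>g\<leftarrow>gs. winding_number g z) = 0" by (simp only: sum_list_0)
    then show False using assms that by (simp add: pos_boundary_param_def)
  qed
  then show ?thesis by (auto simp: bounded_iff)
qed

context octonionic_resolvent
begin

text \<open>A real boundary point is only known to lie in the resolvent set of some slice. It is nevertheless a
  limit of non-real boundary points, for which that slice must be the one of J.\<close>
lemma compl_slice_subset_\<rho>:
  assumes adm: "left_admissible L R T U" and bd: "pos_boundary_param (oslice U J) gs"
  shows "- oslice U J \<subseteq> \<rho>"
proof
  define D where "D = oslice U J"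
  have D: "open D" "connected D" using adm J by (auto simp: D_def left_admissible_def slice_domain_def)
  have "- J \<in> osphere" using J by (simp add: osphere_def omult_minus)
  have sym: "cnj z \<in> D" if "z \<in> D" for z
  proof -
    have "Re z *\<^sub>R oone + Im z *\<^sub>R J \<in> U" using that by (simp add: D_def oslice_def cJ_def)
    then have "Re z *\<^sub>R oone + Im z *\<^sub>R (- J) \<in> U"
      using adm J \<open>- J \<in> osphere\<close> unfolding left_admissible_def axially_symmetric_def by blast
    then show ?thesis by (simp add: D_def oslice_def cJ_def)
  qed
  have rho: "\<exists>I\<in>osphere. cJ J z \<in> rho_star L R T I" if "z \<notin> D" for z
  proof -
    have "cJ J z \<notin> sigma_star L R T"
      using that adm by (auto simp: D_def oslice_def left_admissible_def)
    then show ?thesis by (simp add: sigma_star_def)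
  qed
  have S: "(\<lambda>v. R v (cJ J z) - T v) = S z" for z by (simp add: fun_eq_iff S_def C_def)
  have inv: "invertible_op (S z)" if "z \<notin> D" for z
    using rho[OF that] by (auto simp: rho_star_def S)
  have nonreal: "z \<in> \<rho>" if z: "z \<notin> D" "Im z \<noteq> 0" for z
  proof -
    obtain I where I: "cJ J z \<in> rho_star L R T I" using rho[OF z(1)] by blast
    then have "cJ J z \<in> CJ I" by (simp add: rho_star_def)
    from CJ_subset[OF this z(2)] I
    have "CJ_ext_power_assoc L R J (inv (\<lambda>v. R v (cJ J z) - T v))"
      unfolding CJ_ext_power_assoc_def rho_star_def by blast
    with I show ?thesis by (simp add: \<rho>_def rho_star_def CJ_def)
  qed
  fix s assume "s \<in> - oslice U J"
  then have s: "s \<notin> D" by (simp add: D_def)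
  show "s \<in> \<rho>"
  proof (cases "Im s = 0")
    case False
    then show ?thesis using nonreal s by blast
  next
    case True
    show ?thesis
    proof (rule \<rho>_limit[OF inv[OF s]])
      fix e :: real assume "e > 0"
      have "\<exists>z. z \<notin> D \<and> dist z s < e \<and> Im z \<noteq> 0"
      proof (cases "s \<in> closure D")
        case True
        then have "s \<in> frontier D" using s D(1) by (simp add: frontier_def interior_open)
        then obtain g where g: "g \<in> set gs" "s \<in> path_image g"
          using bd unfolding pos_boundary_param_def D_def by blast
        have sub: "path_image g \<subseteq> frontier D" and g': "simple_path g" "pathfinish g = pathstart g"
          using bd g(1) by (auto simp: pos_boundary_param_def D_def)
        obtain z where z: "z \<in> path_image g" "z \<in> ball s e" "Im z \<noteq> 0"
          using Jordan_nonreal_points_dense[OF D sym g' sub g(2) \<open>Im s = 0\<close> \<open>e > 0\<close>] by blast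
        moreover have "z \<notin> D" using z(1) sub D(1) by (auto simp: frontier_def interior_open)
        ultimately show ?thesis by (auto simp: dist_commute)
      next
        case False
        then obtain d where d: "d > 0" "ball s d \<subseteq> - closure D"
          using open_contains_ball[of "- closure D"] by auto
        define h where "h = min d e / 2"
        have h: "0 < h" "h < d" "h < e" using d(1) \<open>e > 0\<close> by (auto simp: h_def min_def)
        have "s + \<i> * of_real h \<in> ball s d" using h by (simp add: dist_norm norm_mult)
        then have "s + \<i> * of_real h \<notin> D" using d(2) closure_subset by blast
        then show ?thesis
          using h \<open>Im s = 0\<close> by (intro exI[of _ "s + \<i> * of_real h"]) (simp add: dist_norm norm_mult)
      qed
      then show "\<exists>z\<in>\<rho>. dist z s < e" using nonreal by blast
    qed
  qed
qed

lemma res_bound_at_infinity: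
  obtains r K where "r > 0" "K > 0" "\<And>z x. z \<in> \<rho> \<Longrightarrow> norm z \<ge> r \<Longrightarrow> norm (res z x) \<le> K / norm z * norm x"
proof -
  obtain K where K: "K > 0" "\<And>z x. norm (C z x) \<le> K * norm z * norm x" using C_bound by blast
  obtain B where B: "B > 0" "\<And>x. norm (T x) \<le> norm x * B" using bounded_linear.pos_bounded[OF T] by blast
  have "norm (res z x) \<le> 2 * K / norm z * norm x" if z: "z \<in> \<rho>" "norm z \<ge> 2 * K * B" for z x
  proof -
    have "2 * K * B > 0" using K(1) B(1) by simp
    then have "z \<noteq> 0" using z(2) by force
    define y where "y = res z x"
    have "C z y = x + T y"
      using invertible_S(2)[OF \<rho>_invertible[OF z(1)], of x] by (simp add: y_def S_def algebra_simps)
    moreover have "C (1 / z) (C z y) = y" using \<open>z \<noteq> 0\<close> by (simp add: C_simps)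
    ultimately have "norm y \<le> K * norm (1 / z) * norm (x + T y)" using K(2)[of "1 / z" "C z y"] by simp
    also have "\<dots> \<le> K * norm (1 / z) * (norm x + norm y * B)"
      using K(1) B(2)[of y] norm_triangle_ineq[of x "T y"] by (intro mult_left_mono) auto
    also have "\<dots> = K / norm z * norm x + (K * B / norm z) * norm y"
      by (simp add: norm_divide distrib_left add_divide_distrib mult_ac)
    also have "K * B / norm z \<le> 1 / 2" using z(2) \<open>z \<noteq> 0\<close> by (simp add: field_simps)
    finally show ?thesis by (simp add: y_def mult_right_mono)
  qed
  then show ?thesis using K(1) B(1) by (intro that[of "2 * K * B" "2 * K"]) auto
qed

end

locale power_associative_resolvent = octonionic_resolvent L R T J
  for L :: "oct \<Rightarrow> 'v::banach \<Rightarrow> 'v" and R :: "'v \<Rightarrow> oct \<Rightarrow> 'v" and T :: "'v \<Rightarrow> 'v" and J :: oct +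
  assumes T_RO: "T \<in> B_RO L R" and T_power: "power_associative L R T"
begin

lemma T_power_R: "v \<in> ReV L R \<Longrightarrow> (T ^^ n) (R v p) = R ((T ^^ n) v) p"
  using T_power by (intro B_RO_R) (simp_all add: power_associative_def)

lemma functional_res_expand:
  fixes \<phi> :: "'v \<Rightarrow> complex"
  assumes \<phi>: "bounded_linear \<phi>" "\<And>z x. \<phi> (C z x) = z * \<phi> x" and v: "v \<in> ReV L R"
    and z: "z \<in> \<rho>" "z \<noteq> 0"
  shows "\<phi> (res z v) * z ^ m = \<phi> ((T ^^ Suc m) (res z (C (1 / z) v))) + \<phi> ((T ^^ m) v) / z
    + (\<Sum>j<m. \<phi> ((T ^^ (m - 1 - j)) v) * z ^ j)"
proof -
  have lin: "linear \<phi>" using \<phi>(1) by (rule bounded_linear.linear)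
  have Tz: "\<phi> ((T ^^ n) (C w v)) = w * \<phi> ((T ^^ n) v)" for n w
    using T_power_R[OF v] \<phi>(2)[of w "(T ^^ n) v"] by (simp add: C_def)
  have "\<phi> (res z v) * z ^ m = \<phi> (C (1 / z * z ^ Suc m) (res z v))"
    using z(2) by (simp add: \<phi>(2))
  also have "\<dots> = \<phi> ((T ^^ Suc m) (res z (C (1 / z) v)))
      + (\<Sum>j<Suc m. \<phi> ((T ^^ (Suc m - 1 - j)) (C (1 / z * z ^ j) v)))"
    by (simp only: res_C_power[OF z(1) v] linear_add[OF lin] linear_sum[OF lin])
  also have "(\<Sum>j<Suc m. \<phi> ((T ^^ (Suc m - 1 - j)) (C (1 / z * z ^ j) v)))
      = \<phi> ((T ^^ m) v) / z + (\<Sum>j<m. \<phi> ((T ^^ (m - 1 - j)) v) * z ^ j)"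
    unfolding sum.lessThan_Suc_shift Tz using z(2) by (simp add: mult_ac plus_1_eq_Suc)
  finally show ?thesis by (simp add: add.assoc)
qed

lemma contour_integral_circle_asymptotic:
  fixes \<phi> :: "'v \<Rightarrow> complex"
  assumes \<phi>: "bounded_linear \<phi>" "\<And>z x. \<phi> (C z x) = z * \<phi> x" and v: "v \<in> ReV L R"
    and \<rho>: "\<And>z. norm z \<ge> r0 \<Longrightarrow> z \<in> \<rho>"
  obtains K r1 where "\<And>r. r \<ge> r1 \<Longrightarrow>
    norm (contour_integral (circlepath 0 r) (\<lambda>z. \<phi> (res z v) * z ^ m) - 2 * pi * \<i> * \<phi> ((T ^^ m) v)) \<le> K / r"
proof -
  obtain ra Ka where Ka: "ra > 0" "Ka > 0"
    "\<And>z x. z \<in> \<rho> \<Longrightarrow> norm z \<ge> ra \<Longrightarrow> norm (res z x) \<le> Ka / norm z * norm x"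
    by (rule res_bound_at_infinity) blast
  obtain Kc where Kc: "Kc > 0" "\<And>z x. norm (C z x) \<le> Kc * norm z * norm x" using C_bound by blast
  have "bounded_linear (\<lambda>x. \<phi> ((T ^^ Suc m) x))"
    by (rule bounded_linear_compose[OF \<phi>(1) funpow_linear[OF T]])
  then obtain Kb where Kb: "Kb > 0" "\<And>x. norm (\<phi> ((T ^^ Suc m) x)) \<le> norm x * Kb"
    using bounded_linear.pos_bounded by blast
  define K where "K = Ka * Kc * norm v * Kb"
  define r1 where "r1 = max r0 ra"
  define F where "F z = \<phi> (res z v) * z ^ m" for z
  define E where "E z = F z - \<phi> ((T ^^ m) v) / z - (\<Sum>j<m. \<phi> ((T ^^ (m - 1 - j)) v) * z ^ j)" for z
  have "norm (contour_integral (circlepath 0 r) F - 2 * pi * \<i> * \<phi> ((T ^^ m) v)) \<le> K * 2 * pi / r"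
    if r: "r \<ge> r1" for r
  proof -
    have r_pos: "r > 0" using r Ka(1) by (auto simp: r1_def)
    have circ: "z \<in> \<rho>" "z \<noteq> 0" "norm z = r" "norm z \<ge> ra" if "z \<in> path_image (circlepath 0 r)" for z
      using that r r_pos \<rho>[of z] by (auto simp: r1_def)
    have bound: "norm (E z) \<le> K / r\<^sup>2" if "norm (z - 0) = r" for z
    proof -
      have z: "z \<in> \<rho>" "z \<noteq> 0" "norm z = r" "norm z \<ge> ra"
        using circ[of z] that r_pos by (auto simp: sphere_def dist_norm)
      have "norm (res z (C (1 / z) v)) \<le> Ka / r * (Kc * (1 / r) * norm v)"
        using Ka(3)[OF z(1,4), of "C (1 / z) v"] Kc(2)[of "1 / z" v] Ka(2) z(3) r_pos
        by (smt (verit) divide_nonneg_nonneg mult_left_mono norm_divide norm_ge_zero norm_one)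
      then have "norm (res z (C (1 / z) v)) * Kb \<le> Ka / r * (Kc * (1 / r) * norm v) * Kb"
        using Kb(1) by (intro mult_right_mono) auto
      moreover have "E z = \<phi> ((T ^^ Suc m) (res z (C (1 / z) v)))"
        unfolding E_def F_def functional_res_expand[OF \<phi> v z(1,2)] by (simp del: funpow.simps)
      ultimately have "norm (E z) \<le> Ka / r * (Kc * (1 / r) * norm v) * Kb"
        using Kb(2)[of "res z (C (1 / z) v)"] by (metis order_trans)
      also have "\<dots> = K / r\<^sup>2" by (simp add: K_def power2_eq_square)
      finally show ?thesis .
    qed
    obtain \<Omega> where \<Omega>: "open \<Omega>" "\<rho> \<subseteq> \<Omega>" "(\<lambda>z. \<phi> (res z v)) holomorphic_on \<Omega>"
      using res_analytic[OF \<phi> v] unfolding analytic_on_holomorphic by blast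
    have "F contour_integrable_on circlepath 0 r"
    proof (rule contour_integrable_holomorphic_simple[OF _ \<Omega>(1)])
      show "F holomorphic_on \<Omega>" unfolding F_def by (intro holomorphic_intros \<Omega>)
    qed (use circ \<Omega>(2) in auto)
    then have 1: "(F has_contour_integral contour_integral (circlepath 0 r) F) (circlepath 0 r)"
      by (rule has_contour_integral_integral)
    have "((\<lambda>w. \<phi> ((T ^^ m) v) / (w - 0)) has_contour_integral (2 * of_real pi * \<i> * \<phi> ((T ^^ m) v))) (circlepath 0 r)"
      by (rule Cauchy_integral_circlepath_simple) (use r_pos in auto)
    then have 2: "((\<lambda>w. \<phi> ((T ^^ m) v) / w) has_contour_integral (2 * of_real pi * \<i> * \<phi> ((T ^^ m) v))) (circlepath 0 r)"
      by simp
    have 3: "((\<lambda>z. \<Sum>j<m. \<phi> ((T ^^ (m - 1 - j)) v) * z ^ j) has_contour_integral 0) (circlepath 0 r)"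
      by (rule Cauchy_theorem_convex_simple[of _ UNIV]) (auto intro!: holomorphic_intros)
    have "(E has_contour_integral
        (contour_integral (circlepath 0 r) F - 2 * of_real pi * \<i> * \<phi> ((T ^^ m) v) - 0)) (circlepath 0 r)"
      unfolding E_def[abs_def] by (intro has_contour_integral_diff 1 2 3)
    from has_contour_integral_bound_circlepath[OF this _ r_pos bound]
    have "norm (contour_integral (circlepath 0 r) F - 2 * of_real pi * \<i> * \<phi> ((T ^^ m) v) - 0)
        \<le> K / r\<^sup>2 * (2 * pi * r)"
      using Ka(2) Kc(1) Kb(1) by (simp add: K_def)
    also have "\<dots> = K * 2 * pi / r" using r_pos by (simp add: power2_eq_square field_simps)
    finally show ?thesis by simp
  qed
  then show ?thesis unfolding F_def by (rule that)
qed

lemma sum_contour_integrals_res: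
  fixes \<phi> :: "'v \<Rightarrow> complex"
  assumes adm: "left_admissible L R T U" and bd: "pos_boundary_param (oslice U J) gs"
    and \<phi>: "bounded_linear \<phi>" "\<And>z x. \<phi> (C z x) = z * \<phi> x" and v: "v \<in> ReV L R"
  shows "(\<Sum>g\<leftarrow>gs. contour_integral g (\<lambda>z. \<phi> (res z v) * z ^ m)) = 2 * pi * \<i> * \<phi> ((T ^^ m) v)"
proof -
  define D where "D = oslice U J"
  have D: "open D" "connected D" "D \<noteq> {}"
    using adm J by (auto simp: D_def left_admissible_def slice_domain_def)
  then obtain z0 where z0: "z0 \<in> D" by blast
  have sub: "- D \<subseteq> \<rho>" using compl_slice_subset_\<rho>[OF adm bd] by (simp add: D_def)
  obtain \<Omega> where \<Omega>: "open \<Omega>" "\<rho> \<subseteq> \<Omega>" "(\<lambda>z. \<phi> (res z v)) holomorphic_on \<Omega>"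
    using res_analytic[OF \<phi> v] unfolding analytic_on_holomorphic by blast
  define F where "F z = \<phi> (res z v) * z ^ m" for z
  have F: "F holomorphic_on \<Omega>" unfolding F_def by (intro holomorphic_intros \<Omega>)
  have "bounded (closure D)" using pos_boundary_param_bounded[OF bd] by (simp add: D_def bounded_closure)
  then obtain r0 where r0: "r0 > 0" "closure D \<subseteq> ball 0 r0"
    using bounded_subset_ballD by blast
  have g: "valid_path g" "simple_path g" "pathfinish g = pathstart g" "path_image g \<subseteq> frontier D"
    if "g \<in> set gs" for g
    using bd that by (auto simp: pos_boundary_param_def D_def)
  have DF: "D \<inter> frontier D = {}" "D \<subseteq> closure D" "frontier D \<subseteq> closure D"
    using D(1) closure_subset by (auto simp: frontier_def interior_open)
  have circle: "contour_integral g F = winding_number g z0 * contour_integral (circlepath 0 r) F"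
    if "g \<in> set gs" "r \<ge> r0" for g r
  proof (rule Jordan_contour_integral_circlepath[OF D(2) z0 _ g(1-3)[OF that(1)] \<Omega>(1) _ F])
    show "D \<inter> path_image g = {}" using g(4)[OF that(1)] DF by blast
    show "- D \<subseteq> \<Omega>" using sub \<Omega>(2) by blast
    have "ball 0 r0 \<subseteq> ball (0::complex) r" using that(2) by (rule subset_ball)
    then show "D \<union> path_image g \<subseteq> ball 0 r" using g(4)[OF that(1)] DF r0(2) by blast
    show "r > 0" using that(2) r0(1) by simp
  qed
  define c where "c = (\<Sum>g\<leftarrow>gs. contour_integral g F)"
  have c: "c = contour_integral (circlepath 0 r) F" if "r \<ge> r0" for r
  proof -
    have "c = (\<Sum>g\<leftarrow>gs. winding_number g z0 * contour_integral (circlepath 0 r) F)"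
      unfolding c_def using circle[OF _ that] by (metis (mono_tags, lifting) map_eq_conv)
    also have "\<dots> = (\<Sum>g\<leftarrow>gs. winding_number g z0) * contour_integral (circlepath 0 r) F"
      by (rule sum_list_mult_const)
    also have "(\<Sum>g\<leftarrow>gs. winding_number g z0) = 1"
      using bd z0 by (simp add: pos_boundary_param_def D_def)
    finally show ?thesis by simp
  qed
  have "z \<in> \<rho>" if "norm z \<ge> r0" for z
    using that sub r0(2) DF(2) by (force simp: subset_iff)
  then obtain K r1 where K: "\<And>r. r \<ge> r1 \<Longrightarrow>
      norm (contour_integral (circlepath 0 r) F - 2 * pi * \<i> * \<phi> ((T ^^ m) v)) \<le> K / r"
    unfolding F_def using contour_integral_circle_asymptotic[OF \<phi> v, of r0 m] by blast
  have "\<forall>\<^sub>F r in at_top. norm (c - 2 * pi * \<i> * \<phi> ((T ^^ m) v)) \<le> K / r"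
    using eventually_ge_at_top[of "max r0 r1"] by eventually_elim (use c K in auto)
  moreover have "((\<lambda>r. K / r) \<longlongrightarrow> 0) at_top"
    by (rule tendsto_divide_0[OF tendsto_const filterlim_at_top_imp_at_infinity[OF filterlim_ident]])
  ultimately have "norm (c - 2 * pi * \<i> * \<phi> ((T ^^ m) v)) \<le> 0"
    by (intro tendsto_lowerbound[of _ 0 at_top]) auto
  then show ?thesis by (simp add: c_def F_def[abs_def])
qed

lemma integral_formula:
  assumes adm: "left_admissible L R T U" and bd: "pos_boundary_param (oslice U J) gs"
  shows "\<exists>I. (\<forall>k<length gs. (integrand L R T J m (gs ! k) has_integral I k) {0..1}) \<and>
    (1 / (2 * pi)) *\<^sub>R (\<Sum>k<length gs. I k) = Blinfun (T ^^ m)"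
proof -
  define D where "D = oslice U J"
  have "open D" using adm J by (auto simp: D_def left_admissible_def slice_domain_def)
  have g: "valid_path g" "path_image g \<subseteq> \<rho>" if "g \<in> set gs" for g
  proof -
    show "valid_path g" using bd that by (auto simp: pos_boundary_param_def)
    have "path_image g \<subseteq> frontier D" using bd that by (auto simp: pos_boundary_param_def D_def)
    also have "\<dots> \<subseteq> - D" using \<open>open D\<close> by (auto simp: frontier_def interior_open)
    also have "\<dots> \<subseteq> \<rho>" using compl_slice_subset_\<rho>[OF adm bd] by (simp add: D_def)
    finally show "path_image g \<subseteq> \<rho>" .
  qed
  have in_\<rho>: "g t \<in> \<rho>" if "g \<in> set gs" "t \<in> {0..1}" for g t
    using g(2)[OF that(1)] that(2) by (auto simp: path_image_def)
  define I where "I g = integral {0..1} (integrand L R T J m g)" for g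
  have I: "(integrand L R T J m g has_integral I g) {0..1}" if "g \<in> set gs" for g
    unfolding I_def using integrand_integrable[OF g[OF that]] by (rule integrable_integral)
  have I_apply: "((\<lambda>t. integrand L R T J m g t x) has_integral I g x) {0..1}" if "g \<in> set gs" for g x
    using has_integral_linear[OF I[OF that] blinfun.bounded_linear_left[of x]] by (simp add: o_def)
  have I_R: "I g (R v p) = R (I g v) p" if "g \<in> set gs" "v \<in> ReV L R" for g v p
  proof (rule has_integral_unique[OF I_apply[OF that(1)]])
    have "((\<lambda>t. R (integrand L R T J m g t v) p) has_integral R (I g v) p) {0..1}"
      using has_integral_linear[OF I_apply[OF that(1), of v] bounded_linear_R[of p]] by (simp add: o_def)
    then show "((\<lambda>t. integrand L R T J m g t (R v p)) has_integral R (I g v) p) {0..1}"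
      by (rule has_integral_eq[rotated])
        (simp add: integrand_res in_\<rho>[OF that(1)] ext_op_R[OF that(2)] ext_op_ReV[OF that(2)])
  qed
  define X where "X = (1 / (2 * pi)) *\<^sub>R (\<Sum>g\<leftarrow>gs. I g)"
  have X_apply: "X x = (1 / (2 * pi)) *\<^sub>R (\<Sum>g\<leftarrow>gs. I g x)" for x
  proof -
    have "blinfun_apply (\<Sum>g\<leftarrow>hs. I g) x = (\<Sum>g\<leftarrow>hs. I g x)" for hs
      by (induction hs) (simp_all add: blinfun.add_left)
    then show ?thesis by (simp add: X_def blinfun.scaleR_left)
  qed
  have X_T: "X v = (T ^^ m) v" if v: "v \<in> ReV L R" for v
  proof (rule ccontr)
    assume "X v \<noteq> (T ^^ m) v"
    then obtain \<phi> :: "'v \<Rightarrow> complex" where \<phi>: "bounded_linear \<phi>" "\<And>z x. \<phi> (C z x) = z * \<phi> x"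
        "\<phi> (X v - (T ^^ m) v) \<noteq> 0"
      using ex_C_functional[of "X v - (T ^^ m) v"] by auto
    have lin: "linear \<phi>" using \<phi>(1) by (rule bounded_linear.linear)
    have contour: "\<phi> (I g v) = - \<i> * contour_integral g (\<lambda>z. \<phi> (res z v) * z ^ m)" if "g \<in> set gs" for g
    proof -
      have "((\<lambda>t. \<phi> (integrand L R T J m g t v)) has_integral \<phi> (I g v)) {0..1}"
        using has_integral_linear[OF I_apply[OF that, of v] \<phi>(1)] by (simp add: o_def)
      then have "((\<lambda>t. - \<i> * (\<phi> (res (g t) v) * g t ^ m * vector_derivative g (at t)))
          has_integral \<phi> (I g v)) {0..1}"
        by (rule has_integral_eq[rotated])
          (simp add: integrand_res in_\<rho>[OF that] ext_op_ReV[OF v] Blinfun_res Cop_C \<phi>(2) mult_ac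
            del: Cop_apply)
      from has_integral_mult_right[OF this, of \<i>]
      have "((\<lambda>z. \<phi> (res z v) * z ^ m) has_contour_integral \<i> * \<phi> (I g v)) g"
        unfolding has_contour_integral by (simp add: mult.assoc[symmetric])
      then show ?thesis by (simp add: contour_integral_unique)
    qed
    have "\<phi> (X v) = (1 / (2 * pi)) *\<^sub>R (\<Sum>g\<leftarrow>gs. \<phi> (I g v))"
    proof -
      have "\<phi> (\<Sum>g\<leftarrow>hs. I g v) = (\<Sum>g\<leftarrow>hs. \<phi> (I g v))" for hs
        by (induction hs) (simp_all add: linear_add[OF lin] linear_0[OF lin])
      then show ?thesis by (simp add: X_apply linear_cmul[OF lin])
    qed
    also have "(\<Sum>g\<leftarrow>gs. \<phi> (I g v)) = (\<Sum>g\<leftarrow>gs. - \<i> * contour_integral g (\<lambda>z. \<phi> (res z v) * z ^ m))"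
      using contour by (metis (mono_tags, lifting) map_eq_conv)
    also have "\<dots> = - \<i> * (2 * pi * \<i> * \<phi> ((T ^^ m) v))"
      unfolding sum_list_const_mult sum_contour_integrals_res[OF adm bd \<phi>(1,2) v] ..
    also have "(1 / (2 * pi)) *\<^sub>R \<dots> = \<phi> ((T ^^ m) v)"
      by (simp add: scaleR_conv_of_real field_simps)
    finally show False using \<phi>(3) by (simp add: linear_diff[OF lin])
  qed
  have "Blinfun (blinfun_apply X) = ext_op (Blinfun (T ^^ m))"
  proof (rule eq_ext_op[OF blinfun.bounded_linear_right])
    fix v p assume v: "v \<in> ReV L R"
    have "X (R v p) = R (X v) p"
    proof -
      have "(\<Sum>g\<leftarrow>hs. R (I g v) p) = R (\<Sum>g\<leftarrow>hs. I g v) p" for hs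
        by (induction hs) (simp_all add: R_simps)
      moreover have "map (\<lambda>g. I g (R v p)) gs = map (\<lambda>g. R (I g v) p) gs"
        using I_R[OF _ v] by simp
      ultimately show ?thesis by (simp add: X_apply R_simps del: map_eq_conv)
    qed
    then show "X (R v p) = R (Blinfun (T ^^ m) v) p" using X_T[OF v] by (simp add: Blinfun_T)
  qed
  also have "ext_op (Blinfun (T ^^ m)) = Blinfun (T ^^ m)"
    by (rule eq_ext_op[symmetric]) (simp_all add: funpow_linear[OF T] T_power_R Blinfun_T)
  finally have "X = Blinfun (T ^^ m)" by (simp add: blinfun_apply_inverse)
  then have "(1 / (2 * pi)) *\<^sub>R (\<Sum>k<length gs. I (gs ! k)) = Blinfun (T ^^ m)"
    by (simp add: X_def sum_list_sum_nth atLeast0LessThan)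
  then show ?thesis using I by (intro exI[of _ "\<lambda>k. I (gs ! k)"]) simp
qed

end

theorem mainTheorem12:
  fixes L :: "oct \<Rightarrow> 'v::banach \<Rightarrow> 'v" and R :: "'v \<Rightarrow> oct \<Rightarrow> 'v"
    and T :: "'v \<Rightarrow> 'v" and U :: "oct set" and J :: oct and m :: nat
    and gs :: "(real \<Rightarrow> complex) list"
  assumes "banach_O_bimodule L R"
    and "T \<in> B_RO L R"
    and "power_associative L R T"
    and "left_admissible L R T U"
    and "J \<in> osphere"
    and "pos_boundary_param (oslice U J) gs"
  shows "\<exists>I. (\<forall>k<length gs. (integrand L R T J m (gs ! k) has_integral I k) {0..1}) \<and>
             (1 / (2 * pi)) *\<^sub>R (\<Sum>k<length gs. I k) = Blinfun (T ^^ m)"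
proof -
  interpret power_associative_resolvent L R T J
    using assms
    by (intro power_associative_resolvent.intro octonionic_resolvent.intro banach_octonion_bimodule.intro
        octonion_bimodule.intro banach_octonion_bimodule_axioms.intro octonionic_resolvent_axioms.intro
        power_associative_resolvent_axioms.intro)
      (simp_all add: banach_O_bimodule_def B_RO_def)
  show ?thesis by (rule integral_formula[OF assms(4,6)])
qed

end
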